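(* The absorbing discrete diffusion objective (denoising score entropy loss) $$\mathcal{L}_{\mathrm{DSE}}^{T}(\mathbf{x}_0)=\int_0^T\mathbb{E}_{\mathbf{x}_t\sim p_{t|0}(\mathbf{x}_t\mid\mathbf{x}_0)}\sum_{\hat{\mathbf{x}}_t\neq\mathbf{x}_t}\mathbf{Q}_t(\hat{\mathbf{x}}_t,\mathbf{x}_t)\left(\mathbf{s}_\theta(\mathbf{x}_t,t)_{\hat{\mathbf{x}}_t}-\frac{p_{t|0}(\hat{\mathbf{x}}_t\mid\mathbf{x}_0)}{p_{t|0}(\mathbf{x}_t\mid\mathbf{x}_0)}\log\mathbf{s}_\theta(\mathbf{x}_t,t)_{\hat{\mathbf{x}}_t}+K\!\left(\frac{p_{t|0}(\hat{\mathbf{x}}_t\mid\mathbf{x}_0)}{p_{t|0}(\mathbf{x}_t\mid\mathbf{x}_0)}\right)\right)dt$$ is equivalent to the any-order autoregressive objective $$\mathcal{L}_{AO}(\mathbf{x}_0)=\mathbb{E}_{\pi\sim U_\pi}\sum_{l=1}^d-\log q_\theta\big(x_0^{\pi(l)}\mid x_0^{\pi(<l)};\pi\big)$$ when the final total noise level $\bar\sigma(T)\to+\infty$.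
   Context: Tokens: $\mathcal{X}=\{1,\ldots,N\}$ is a finite set of tokens whose last state is a special mask token $[\mathbf{M}]$. The absorbing rate matrix $\mathbf{Q}^{\mathrm{absorb}}\in\mathbb{R}^{N\times N}$ has $\mathbf{Q}^{\mathrm{absorb}}(x,x)=-1$ and $\mathbf{Q}^{\mathrm{absorb}}(x,[\mathbf{M}])=1$ for every $x\neq[\mathbf{M}]$, and all other entries (in particular the whole row of $[\mathbf{M}]$) equal to $0$. Forward process on $[0,T]$: $\sigma(t)$ is a scalar function (the noise schedule) and $\bar\sigma(t)=\int_0^t\sigma(s)\,ds$; $\bar\sigma(T)$ is the final total noise level. The $d$ coordinates of a sequence $\mathbf{x}=x^1\cdots x^d$ evolve independently, each as a continuous-time Markov chain on $\mathcal{X}$ with transition rate matrix $\sigma(t)\mathbf{Q}^{\mathrm{absorb}}$; so by time $t$ each token has been masked with probability $1-e^{-\bar\sigma(t)}$, and $\bar\sigma(T)\to+\infty$ means all tokens are finally masked with probability one. $p_{t|0}(\cdot\mid\mathbf{x}_0)$ is the law at time $t$ started from the clean (mask-free) sequence $\mathbf{x}_0$ of length $d$. $\mathbf{Q}_t$ is the resulting rate matrix on $\mathcal{X}^d$: $\mathbf{Q}_t(\hat{\mathbf{x}},\mathbf{x})$ (rate from $\hat{\mathbf{x}}$ to $\mathbf{x}$) equals $\sigma(t)\mathbf{Q}^{\mathrm{absorb}}(\hat{x}^i,x^i)$ if the two sequences differ exactly in position $i$, and $0$ if they differ in more than one position. Hence, for $\hat{\mathbf{x}}\neq\mathbf{x}$,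 only those $\hat{\mathbf{x}}$ contribute that are obtained from $\mathbf{x}$ by replacing exactly one $[\mathbf{M}]$ by a non-mask token, and then the rate is $\sigma(t)$. $K(a)=a\log a-a$, with the convention $0\log 0=0$. Model: $\mathbf{c}_\theta$ is a time-independent network (with softmax output) giving, for each $\mathbf{x}\in\mathcal{X}^d$ and each position $i$ with $x^i=[\mathbf{M}]$, a probability distribution $\mathbf{c}_\theta(\mathbf{x})[i,\cdot]$ on the non-mask tokens. It defines model conditional distributions $q_\theta(x^i=j\mid\mathbf{x}^{\mathrm{UM}})=\mathbf{c}_\theta(\mathbf{x})[i,j]$, where $\mathbf{x}^{\mathrm{UM}}$ consists of all unmasked tokens of $\mathbf{x}$. The score network, which approximates $p_t(\hat{\mathbf{x}})/p_t(\mathbf{x})$ with $p_t$ the marginal law of the forward process at time $t$, is parameterized as $$\mathbf{s}_\theta(\mathbf{x},t)_{\hat{\mathbf{x}}}=\frac{e^{-\bar\sigma(t)}}{1-e^{-\bar\sigma(t)}}\,\mathbf{c}_\theta(\mathbf{x})[i,\hat{x}^i]$$ when $\hat{\mathbf{x}}$ differs from $\mathbf{x}$ only in position $i$, with $x^i=[\mathbf{M}]$ and $\hat{x}^i\neq[\mathbf{M}]$. Any-order autoregressive model with the same network: $U_\pi$ is the uniform distribution over all orders (permutations) $\pi$ of $\{1,\ldots,d\}$; $x_0^{\pi(<l)}$ denotes the tokens of $\mathbf{x}_0$ at positions $\pi(1),\ldots,\pi(l-1)$; and $q_\theta(x_0^{\pi(l)}\mid x_0^{\pi(<l)};\pi)=\mathbf{c}_\theta(\mathbf{x}')[\pi(l),x_0^{\pi(l)}]$,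 where $\mathbf{x}'$ agrees with $\mathbf{x}_0$ at positions $\pi(1),\ldots,\pi(l-1)$ and equals $[\mathbf{M}]$ elsewhere. "Equivalent" is used in the sense that one loss can be rewritten as the other. *)

theory Defs
  imports "HOL-Probability.Probability" "HOL-Combinatorics.Permutations"
begin

text \<open>
  \<open>R t x y\<close> is the rate from \<open>x\<close> to \<open>y\<close> at time \<open>t\<close>, and \<open>P s t x y\<close> the probability of
  being in \<open>y\<close> at time \<open>t\<close> given \<open>x\<close> at time \<open>s\<close>.  The Kolmogorov forward equation
  \<open>dP(s,t)/dt = P(s,t) R(t)\<close>, \<open>P(s,s) = I\<close> is stated in integrated form, since the rates are
  only assumed to be integrable in time; where \<open>R\<close> is continuous this is the differential form.
\<close>

definition forward_equation ::
  "'a set \<Rightarrow> (real \<Rightarrow> 'a \<Rightarrow> 'a \<Rightarrow> real) \<Rightarrow> real \<Rightarrow> (real \<Rightarrow> real \<Rightarrow> 'a \<Rightarrow> 'a \<Rightarrow> real) \<Rightarrow> bool" where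
  "forward_equation S R T P \<longleftrightarrow>
     (\<forall>s t. 0 \<le> s \<and> s \<le> t \<and> t \<le> T \<longrightarrow> (\<forall>x\<in>S. \<forall>y\<in>S.
        ((\<lambda>u. \<Sum>z\<in>S. P s u x z * R u z y) has_integral (P s t x y - of_bool (x = y))) {s..t}))"

text \<open>The Markov property is expressed through the finite-dimensional distributions.\<close>

definition ctmc ::
  "'w measure \<Rightarrow> 'a set \<Rightarrow> (real \<Rightarrow> 'a \<Rightarrow> 'a \<Rightarrow> real) \<Rightarrow> real \<Rightarrow> (real \<Rightarrow> 'w \<Rightarrow> 'a) \<Rightarrow> bool" where
  "ctmc M S R T X \<longleftrightarrow>
     prob_space M \<and>
     (\<forall>t\<in>{0..T}. X t \<in> M \<rightarrow>\<^sub>M count_space S) \<and>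
     (\<exists>P. forward_equation S R T P \<and>
        (\<forall>(n::nat) ts xs. (\<forall>k\<le>n. ts k \<in> {0..T} \<and> xs k \<in> S) \<and> (\<forall>k<n. ts k \<le> ts (Suc k)) \<longrightarrow>
           \<P>(\<omega> in M. \<forall>k\<le>n. X (ts k) \<omega> = xs k) =
           \<P>(\<omega> in M. X (ts 0) \<omega> = xs 0) * (\<Prod>k<n. P (ts k) (ts (Suc k)) (xs k) (xs (Suc k)))))"

text \<open>
  Tokens are \<open>1, \<dots>, N\<close> with \<open>N\<close> the mask token; positions are \<open>1, \<dots>, d\<close>; sequences are
  extensional functions on the positions.
\<close>

type_synonym tokseq = "nat \<Rightarrow> nat"

definition seqs :: "nat \<Rightarrow> nat \<Rightarrow> tokseq set" where
  "seqs N d = {1..d} \<rightarrow>\<^sub>E {1..N}"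

definition clean_seqs :: "nat \<Rightarrow> nat \<Rightarrow> tokseq set" where
  "clean_seqs N d = {1..d} \<rightarrow>\<^sub>E {1..<N}"

definition Q_absorb :: "nat \<Rightarrow> nat \<Rightarrow> nat \<Rightarrow> real" where
  "Q_absorb N x y = (if x = N then 0 else if y = x then -1 else if y = N then 1 else 0)"

definition sigma_bar :: "(real \<Rightarrow> real) \<Rightarrow> real \<Rightarrow> real" where
  "sigma_bar \<sigma> t = integral {0..t} \<sigma>"

text \<open>
  \<open>X i t\<close> is the token at position \<open>i\<close> at time \<open>t\<close>; independence of the coordinates is
  independence of their whole paths.
\<close>

definition forward_process ::
  "'w measure \<Rightarrow> nat \<Rightarrow> nat \<Rightarrow> (real \<Rightarrow> real) \<Rightarrow> real \<Rightarrow> tokseq \<Rightarrow> (nat \<Rightarrow> real \<Rightarrow> 'w \<Rightarrow> nat) \<Rightarrow> bool" where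
  "forward_process M N d \<sigma> T x0 X \<longleftrightarrow>
     prob_space M \<and>
     (\<forall>i\<in>{1..d}. ctmc M {1..N} (\<lambda>t x y. \<sigma> t * Q_absorb N x y) T (X i)) \<and>
     prob_space.indep_vars M (\<lambda>_. Pi\<^sub>M {0..T} (\<lambda>_. count_space {1..N}))
       (\<lambda>i \<omega>. \<lambda>t\<in>{0..T}. X i t \<omega>) {1..d} \<and>
     (\<forall>i\<in>{1..d}. AE \<omega> in M. X i 0 \<omega> = x0 i)"

definition marginal :: "'w measure \<Rightarrow> nat \<Rightarrow> (nat \<Rightarrow> real \<Rightarrow> 'w \<Rightarrow> nat) \<Rightarrow> real \<Rightarrow> tokseq \<Rightarrow> real" where
  "marginal M d X t x = \<P>(\<omega> in M. \<forall>i\<in>{1..d}. X i t \<omega> = x i)"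

text \<open>
  The rate from \<open>xh\<close> to \<open>x\<close>.  If the sequences differ exactly in position \<open>i\<close>, only the
  \<open>i\<close>-th summand survives; if they differ in more positions, none does.  On the diagonal one
  gets the sum of the coordinates' diagonal rates.
\<close>

definition Q_seq :: "nat \<Rightarrow> nat \<Rightarrow> (real \<Rightarrow> real) \<Rightarrow> real \<Rightarrow> tokseq \<Rightarrow> tokseq \<Rightarrow> real" where
  "Q_seq N d \<sigma> t xh x =
     (\<Sum>i=1..d. if \<forall>j\<in>{1..d} - {i}. xh j = x j then \<sigma> t * Q_absorb N (xh i) (x i) else 0)"

definition K :: "real \<Rightarrow> real" where
  "K a = a * ln a - a"  \<comment> \<open>\<open>ln 0 = 0\<close>, so \<open>K 0 = 0\<close>\<close>

definition softmax :: "'a set \<Rightarrow> ('a \<Rightarrow> real) \<Rightarrow> 'a \<Rightarrow> real" where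
  "softmax A z j = exp (z j) / (\<Sum>k\<in>A. exp (z k))"

definition softmax_network :: "nat \<Rightarrow> nat \<Rightarrow> (tokseq \<Rightarrow> nat \<Rightarrow> nat \<Rightarrow> real) \<Rightarrow> bool" where
  "softmax_network N d c \<longleftrightarrow>
     (\<forall>x\<in>seqs N d. \<forall>i\<in>{1..d}. x i = N \<longrightarrow> (\<exists>z. \<forall>j\<in>{1..<N}. c x i j = softmax {1..<N} z j))"

text \<open>
  Only meaningful when \<open>xh\<close> differs from \<open>x\<close> in exactly one position, where \<open>x\<close> is masked and
  \<open>xh\<close> is not; these are the only \<open>xh \<noteq> x\<close> with \<open>Q_seq N d \<sigma> t xh x \<noteq> 0\<close>, so the other
  values do not enter the loss.
\<close>

definition score ::
  "nat \<Rightarrow> (tokseq \<Rightarrow> nat \<Rightarrow> nat \<Rightarrow> real) \<Rightarrow> (real \<Rightarrow> real) \<Rightarrow> tokseq \<Rightarrow> real \<Rightarrow> tokseq \<Rightarrow> real" where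
  "score d c \<sigma> x t xh =
     (let i = (THE i. i \<in> {1..d} \<and> xh i \<noteq> x i)
      in exp (- sigma_bar \<sigma> t) / (1 - exp (- sigma_bar \<sigma> t)) * c x i (xh i))"

text \<open>
  \<open>p t\<close> is the probability mass function of the noised sequence at time \<open>t\<close>.  Terms with
  \<open>p t x = 0\<close>, whose probability ratios are undefined, have weight zero in the expectation.
\<close>

definition dse_integrand ::
  "nat \<Rightarrow> nat \<Rightarrow> (tokseq \<Rightarrow> nat \<Rightarrow> nat \<Rightarrow> real) \<Rightarrow> (real \<Rightarrow> real) \<Rightarrow> (real \<Rightarrow> tokseq \<Rightarrow> real) \<Rightarrow> real \<Rightarrow> real" where
  "dse_integrand N d c \<sigma> p t =
     (\<Sum>x\<in>seqs N d. p t x *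
        (\<Sum>xh\<in>seqs N d - {x}. Q_seq N d \<sigma> t xh x *
           (score d c \<sigma> x t xh - p t xh / p t x * ln (score d c \<sigma> x t xh) + K (p t xh / p t x))))"

definition dse_loss ::
  "nat \<Rightarrow> nat \<Rightarrow> (tokseq \<Rightarrow> nat \<Rightarrow> nat \<Rightarrow> real) \<Rightarrow> (real \<Rightarrow> real) \<Rightarrow> real \<Rightarrow> (real \<Rightarrow> tokseq \<Rightarrow> real) \<Rightarrow> real" where
  "dse_loss N d c \<sigma> T p = integral {0..T} (dse_integrand N d c \<sigma> p)"

definition keep_only :: "nat \<Rightarrow> nat \<Rightarrow> nat set \<Rightarrow> tokseq \<Rightarrow> tokseq" where
  "keep_only N d U x = (\<lambda>i\<in>{1..d}. if i \<in> U then x i else N)"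

text \<open>
  The model probability that token \<open>i\<close> is \<open>j\<close>, given the tokens of \<open>x\<close> at the positions in \<open>U\<close>.
\<close>

definition model_cond ::
  "nat \<Rightarrow> nat \<Rightarrow> (tokseq \<Rightarrow> nat \<Rightarrow> nat \<Rightarrow> real) \<Rightarrow> nat set \<Rightarrow> tokseq \<Rightarrow> nat \<Rightarrow> nat \<Rightarrow> real" where
  "model_cond N d c U x i j = c (keep_only N d U x) i j"

definition ao_loss :: "nat \<Rightarrow> nat \<Rightarrow> (tokseq \<Rightarrow> nat \<Rightarrow> nat \<Rightarrow> real) \<Rightarrow> tokseq \<Rightarrow> real" where
  "ao_loss N d c x0 =
     measure_pmf.expectation (pmf_of_set {\<pi>. \<pi> permutes {1..d}})
       (\<lambda>\<pi>. \<Sum>l=1..d. - ln (model_cond N d c (\<pi> ` {1..<l}) x0 (\<pi> l) (x0 (\<pi> l))))"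

end

theory Submission
  imports Defs
begin

text \<open>
  Given the clean sequence, the tokens at time \<open>t\<close> are independently kept with probability
  \<open>a = exp (- sigma_bar t)\<close> and masked otherwise.  Conditionally on the set \<open>U\<close> of kept positions the
  score entropy collapses to \<open>- ln c\<close> at each masked position, because the normalisation of the
  softmax cancels the remaining terms.  Substituting \<open>a\<close> for \<open>t\<close> turns the weight of
  \<open>(U, i)\<close> into an incomplete Beta integral, which tends to
  \<open>|U|! (d - |U| - 1)! / d!\<close> as the total noise grows.  This is exactly the probability that in a
  uniformly random order the positions \<open>U\<close> come first and are followed by \<open>i\<close>.
\<close>

text \<open>The network does not depend on time, so each \<open>- ln c\<close> leaves the time
  integral as a constant and only weights remain to be integrated. Their power of
  \<open>1 - a\<close> is \<open>d - |U| - 1\<close> and not \<open>d - |U|\<close>, because the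
  probability ratio \<open>a / (1 - a)\<close> cancels one factor. At every finite noise level the
  loss is thus a finite combination of incomplete Beta integrals in the single number
  \<open>exp (- sigma_bar \<sigma> T)\<close>, and the limit needs only continuity at 0, no exchange
  of limit and integral. The obstacle is that \<sigma> is merely nonnegative and integrable. Both
  the law of one token and the substitution are therefore obtained by measuring increments against
  \<open>sigma_bar \<sigma>\<close>, which is continuous and monotone and serves as a clock in place
  of time.\<close>

section \<open>The accumulated noise\<close>

lemma sigma_bar_zero [simp]: "sigma_bar \<sigma> 0 = 0"
  by (simp add: sigma_bar_def)

lemma sigma_bar_diff:
  assumes "\<sigma> integrable_on {0..T}" "0 \<le> s" "s \<le> t" "t \<le> T"
  shows "(\<sigma> has_integral (sigma_bar \<sigma> t - sigma_bar \<sigma> s)) {s..t}"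
proof -
  have i: "\<sigma> integrable_on {0..t}" "\<sigma> integrable_on {s..t}"
    by (rule integrable_on_subinterval[OF assms(1)]; use assms in auto)+
  have "sigma_bar \<sigma> s + integral {s..t} \<sigma> = sigma_bar \<sigma> t"
    unfolding sigma_bar_def by (rule Henstock_Kurzweil_Integration.integral_combine) (use i assms in auto)
  then have "integral {s..t} \<sigma> = sigma_bar \<sigma> t - sigma_bar \<sigma> s" by simp
  with i show ?thesis by (metis integrable_integral)
qed

lemma sigma_bar_mono:
  assumes "\<sigma> integrable_on {0..T}" "\<And>t. t \<in> {0..T} \<Longrightarrow> 0 \<le> \<sigma> t" "0 \<le> s" "s \<le> t" "t \<le> T"
  shows "sigma_bar \<sigma> s \<le> sigma_bar \<sigma> t"
  using has_integral_nonneg[OF sigma_bar_diff[OF assms(1,3-5)]] assms by auto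

lemma sigma_bar_nonneg:
  assumes "\<sigma> integrable_on {0..T}" "\<And>t. t \<in> {0..T} \<Longrightarrow> 0 \<le> \<sigma> t" "t \<in> {0..T}"
  shows "0 \<le> sigma_bar \<sigma> t"
  using sigma_bar_mono[OF assms(1,2), of 0 t] assms(3) by simp

lemma continuous_on_sigma_bar:
  assumes "\<sigma> integrable_on {0..T}"
  shows "continuous_on {0..T} (sigma_bar \<sigma>)"
  unfolding sigma_bar_def by (rule indefinite_integral_continuous_1[OF assms])

section \<open>Calculus with the accumulated noise as clock\<close>

text \<open>Cutting the interval into pieces on which \<open>S\<close> grows by less than \<delta>
  and adding the increments bounds the total change of \<open>h\<close> by
  \<open>\<epsilon> * (S b - S a)\<close>, with \<epsilon> arbitrary. This is the vanishing
  derivative argument with \<open>S\<close> in place of time.\<close>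

lemma constant_if_increments_negligible:
  fixes S h :: "real \<Rightarrow> real"
  assumes "a \<le> b"
    and cont: "continuous_on {a..b} S"
    and mono: "\<And>s t. a \<le> s \<Longrightarrow> s \<le> t \<Longrightarrow> t \<le> b \<Longrightarrow> S s \<le> S t"
    and incr: "\<And>\<epsilon>. \<epsilon> > 0 \<Longrightarrow> \<exists>\<delta>>0. \<forall>s t. a \<le> s \<and> s \<le> t \<and> t \<le> b \<and> S t - S s < \<delta> \<longrightarrow>
      \<bar>h t - h s\<bar> \<le> \<epsilon> * (S t - S s)"
  shows "h b = h a"
proof -
  have bound: "\<bar>h b - h a\<bar> \<le> \<epsilon> * (S b - S a)" if \<epsilon>: "\<epsilon> > 0" for \<epsilon>
  proof -
    obtain \<delta> where \<delta>: "\<delta> > 0" and loc: "\<And>s t. a \<le> s \<Longrightarrow> s \<le> t \<Longrightarrow> t \<le> b \<Longrightarrow> S t - S s < \<delta> \<Longrightarrow>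
      \<bar>h t - h s\<bar> \<le> \<epsilon> * (S t - S s)"
      using incr[OF \<epsilon>] by blast
    have step: "\<bar>h b - h s\<bar> \<le> \<epsilon> * (S b - S s)"
      if "a \<le> s" "s \<le> b" "S b - S s \<le> real n * (\<delta> / 2)" for n s
      using that
    proof (induction n arbitrary: s)
      case 0
      then show ?case using loc[of s b] \<delta> by auto
    next
      case (Suc n)
      show ?case
      proof (cases "S b - S s < \<delta>")
        case True
        then show ?thesis using loc[of s b] Suc.prems by auto
      next
        case False
        have "continuous_on {s..b} S"
          by (rule continuous_on_subset[OF cont]) (use Suc.prems in auto)
        \<comment> \<open>A piece of growth \<open>\<delta> / 2\<close> stays strictly below the
          threshold \<delta> and uses up exactly one unit of the induction budget.\<close>
        then obtain u where u: "s \<le> u" "u \<le> b" "S u = S s + \<delta> / 2"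
          using IVT'[of S s "S s + \<delta> / 2" b] False \<delta> Suc.prems by auto
        have "\<bar>h b - h u\<bar> \<le> \<epsilon> * (S b - S u)"
          using Suc.prems u by (intro Suc.IH) (auto simp: algebra_simps)
        moreover have "\<bar>h u - h s\<bar> \<le> \<epsilon> * (S u - S s)"
          using loc[of s u] u Suc.prems \<delta> by auto
        ultimately have "\<bar>h b - h s\<bar> \<le> \<epsilon> * (S b - S u) + \<epsilon> * (S u - S s)" by linarith
        then show ?thesis by (simp add: algebra_simps)
      qed
    qed
    obtain n where "(S b - S a) / (\<delta> / 2) \<le> real n" using real_arch_simple by blast
    then have "S b - S a \<le> real n * (\<delta> / 2)" using \<delta> by (simp add: field_simps)
    then show ?thesis using step[of a n] \<open>a \<le> b\<close> by simp
  qed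
  have "\<bar>h b - h a\<bar> \<le> 0"
  proof (rule field_le_epsilon)
    fix e :: real assume "e > 0"
    define D where "D = S b - S a"
    have "D \<ge> 0" using mono[of a b] \<open>a \<le> b\<close> by (simp add: D_def)
    then have "e / (D + 1) * D \<le> e" using \<open>e > 0\<close> by (simp add: field_simps)
    moreover have "\<bar>h b - h a\<bar> \<le> e / (D + 1) * D"
      unfolding D_def by (rule bound) (use \<open>e > 0\<close> \<open>D \<ge> 0\<close> in \<open>simp add: D_def\<close>)
    ultimately show "\<bar>h b - h a\<bar> \<le> 0 + e" by simp
  qed
  then show ?thesis by simp
qed

text \<open>The weight will be \<sigma> for integrals over time and the constant 1 for integrals
  over the noise level; in both cases \<open>J\<close> is the growth of the noise level.\<close>

lemma has_integral_weighted_bound: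
  fixes f \<sigma> :: "real \<Rightarrow> real"
  assumes "((\<lambda>u. f u * \<sigma> u) has_integral I) A" "(\<sigma> has_integral J) A"
    "\<And>u. u \<in> A \<Longrightarrow> 0 \<le> \<sigma> u" "\<And>u. u \<in> A \<Longrightarrow> \<bar>f u\<bar> \<le> c"
  shows "\<bar>I\<bar> \<le> c * J"
proof -
  have *: "I = integral A (\<lambda>u. f u * \<sigma> u)" "c * J = integral A (\<lambda>u. c * \<sigma> u)"
    using integral_unique[OF assms(1)] integral_unique[OF has_integral_mult_right[OF assms(2), of c]]
    by (simp_all only:)
  have "norm (integral A (\<lambda>u. f u * \<sigma> u)) \<le> integral A (\<lambda>u. c * \<sigma> u)"
  proof (rule Henstock_Kurzweil_Integration.integral_norm_bound_integral)
    show "(\<lambda>u. f u * \<sigma> u) integrable_on A" using assms(1) by blast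
    show "(\<lambda>u. c * \<sigma> u) integrable_on A" using has_integral_mult_right[OF assms(2)] by blast
    show "norm (f u * \<sigma> u) \<le> c * \<sigma> u" if "u \<in> A" for u
      using assms(3,4)[OF that] by (simp add: abs_mult mult_right_mono)
  qed
  then show ?thesis by (simp add: *)
qed

text \<open>
  \<^term>\<open>sigma_bar \<sigma>\<close> need not be differentiable, so the substitution rules of the library do not
  apply; instead the difference of both sides has negligible increments.
\<close>

lemma has_integral_substitution_sigma_bar:
  fixes \<phi> G :: "real \<Rightarrow> real"
  assumes "0 \<le> T" and int: "\<sigma> integrable_on {0..T}" and nonneg: "\<And>t. t \<in> {0..T} \<Longrightarrow> 0 \<le> \<sigma> t"
    and cont: "continuous_on {0..sigma_bar \<sigma> T} \<phi>"
    and deriv: "\<And>u. u \<in> {0..sigma_bar \<sigma> T} \<Longrightarrow>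
      (G has_real_derivative \<phi> u) (at u within {0..sigma_bar \<sigma> T})"
  shows "((\<lambda>t. \<phi> (sigma_bar \<sigma> t) * \<sigma> t) has_integral (G (sigma_bar \<sigma> T) - G 0)) {0..T}"
proof -
  let ?S = "sigma_bar \<sigma>"
  have range: "?S t \<in> {0..?S T}" if "t \<in> {0..T}" for t
    using sigma_bar_mono[OF int nonneg, of t T] sigma_bar_nonneg[OF int nonneg that] that by auto
  have contS: "continuous_on {0..T} ?S" by (rule continuous_on_sigma_bar[OF int])
  have contf: "continuous_on {0..T} (\<lambda>t. \<phi> (?S t))"
    by (rule continuous_on_compose2[OF cont contS]) (use range in auto)
  \<comment> \<open>Nonnegativity upgrades the integrability of \<sigma> to absolute integrability,
    which survives multiplication by a bounded measurable function.\<close>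
  have "(\<lambda>t. \<phi> (?S t) * \<sigma> t) absolutely_integrable_on {0..T}"
  proof (rule absolutely_integrable_bounded_measurable_product_real)
    show "(\<lambda>t. \<phi> (?S t)) \<in> borel_measurable (lebesgue_on {0..T})"
      by (rule continuous_imp_measurable_on_sets_lebesgue[OF contf]) simp
    show "bounded ((\<lambda>t. \<phi> (?S t)) ` {0..T})"
      by (rule compact_imp_bounded[OF compact_continuous_image[OF contf]]) simp
    show "\<sigma> absolutely_integrable_on {0..T}"
      by (rule nonnegative_absolutely_integrable_1[OF int nonneg])
  qed simp
  then have intf: "(\<lambda>t. \<phi> (?S t) * \<sigma> t) integrable_on {0..T}"
    by (rule set_lebesgue_integral_eq_integral)
  define I where "I t = integral {0..t} (\<lambda>t. \<phi> (?S t) * \<sigma> t)" for t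
  define h where "h t = I t - G (?S t)" for t
  have "h T = h 0"
  proof (rule constant_if_increments_negligible[OF \<open>0 \<le> T\<close> contS])
    show "?S s \<le> ?S t" if "0 \<le> s" "s \<le> t" "t \<le> T" for s t
      by (rule sigma_bar_mono[OF int nonneg that])
    fix \<epsilon> :: real assume "\<epsilon> > 0"
    have "uniformly_continuous_on {0..?S T} \<phi>"
      by (rule compact_uniformly_continuous[OF cont]) simp
    then obtain \<delta> where "\<delta> > 0" and \<delta>: "\<And>u v. u \<in> {0..?S T} \<Longrightarrow> v \<in> {0..?S T} \<Longrightarrow> \<bar>u - v\<bar> < \<delta> \<Longrightarrow>
        \<bar>\<phi> u - \<phi> v\<bar> < \<epsilon> / 2"
      unfolding uniformly_continuous_on_def dist_real_def
      using \<open>\<epsilon> > 0\<close> by (metis half_gt_zero)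
    have "\<bar>h t - h s\<bar> \<le> \<epsilon> * (?S t - ?S s)" if st: "0 \<le> s" "s \<le> t" "t \<le> T" and d: "?S t - ?S s < \<delta>" for s t
    proof -
      have S: "?S u \<in> {?S s..?S t}" if "u \<in> {s..t}" for u
        using sigma_bar_mono[OF int nonneg] that st by auto
      have near: "\<bar>\<phi> u - \<phi> (?S s)\<bar> \<le> \<epsilon> / 2" if "u \<in> {?S s..?S t}" for u
        using \<delta>[of u "?S s"] that d range[of s] range[of t] st by force
      have \<sigma>: "(\<sigma> has_integral (?S t - ?S s)) {s..t}" by (rule sigma_bar_diff[OF int st])
      have i: "(\<lambda>t. \<phi> (?S t) * \<sigma> t) integrable_on {0..t}" "(\<lambda>t. \<phi> (?S t) * \<sigma> t) integrable_on {s..t}"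
        by (rule integrable_on_subinterval[OF intf]; use st in auto)+
      have "I s + integral {s..t} (\<lambda>t. \<phi> (?S t) * \<sigma> t) = I t"
        unfolding I_def by (rule Henstock_Kurzweil_Integration.integral_combine) (use i st in auto)
      then have "integral {s..t} (\<lambda>t. \<phi> (?S t) * \<sigma> t) = I t - I s" by simp
      then have I: "((\<lambda>t. \<phi> (?S t) * \<sigma> t) has_integral (I t - I s)) {s..t}"
        using integrable_integral[OF i(2)] by metis
      have "((\<lambda>u. \<phi> (?S u) * \<sigma> u - \<phi> (?S s) * \<sigma> u) has_integral
          (I t - I s) - \<phi> (?S s) * (?S t - ?S s)) {s..t}"
        by (intro has_integral_diff[OF I] has_integral_mult_right \<sigma>)
      then have "((\<lambda>u. (\<phi> (?S u) - \<phi> (?S s)) * \<sigma> u) has_integral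
          (I t - I s) - \<phi> (?S s) * (?S t - ?S s)) {s..t}"
        by (simp add: algebra_simps)
      then have 1: "\<bar>(I t - I s) - \<phi> (?S s) * (?S t - ?S s)\<bar> \<le> \<epsilon> / 2 * (?S t - ?S s)"
        by (rule has_integral_weighted_bound[OF _ \<sigma>]) (use nonneg st near S in auto)
      have le: "?S s \<le> ?S t" by (rule sigma_bar_mono[OF int nonneg st])
      have G: "(\<phi> has_integral (G (?S t) - G (?S s))) {?S s..?S t}"
      proof (rule fundamental_theorem_of_calculus[OF le])
        fix u assume "u \<in> {?S s..?S t}"
        then have "u \<in> {0..?S T}" "{?S s..?S t} \<subseteq> {0..?S T}" using range[of s] range[of t] st by auto
        then show "(G has_vector_derivative \<phi> u) (at u within {?S s..?S t})"
          using deriv has_field_derivative_subset has_real_derivative_iff_has_vector_derivative by blast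
      qed
      have one: "((\<lambda>_. 1 :: real) has_integral (?S t - ?S s)) {?S s..?S t}"
        using has_integral_const_real[of "1 :: real" "?S s" "?S t"] le by simp
      have "((\<lambda>u. \<phi> u - \<phi> (?S s) * 1) has_integral
          (G (?S t) - G (?S s)) - \<phi> (?S s) * (?S t - ?S s)) {?S s..?S t}"
        by (intro has_integral_diff[OF G] has_integral_mult_right one)
      then have "((\<lambda>u. (\<phi> u - \<phi> (?S s)) * 1) has_integral
          (G (?S t) - G (?S s)) - \<phi> (?S s) * (?S t - ?S s)) {?S s..?S t}"
        by simp
      then have 2: "\<bar>(G (?S t) - G (?S s)) - \<phi> (?S s) * (?S t - ?S s)\<bar> \<le> \<epsilon> / 2 * (?S t - ?S s)"
        by (rule has_integral_weighted_bound[OF _ one]) (use near in auto)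
      have "\<bar>x - y\<bar> \<le> 2 * e" if "\<bar>x - z\<bar> \<le> e" "\<bar>y - z\<bar> \<le> e" for x y z e :: real
        using that by linarith
      from this[OF 1 2] show ?thesis by (simp add: h_def algebra_simps)
    qed
    then show "\<exists>\<delta>>0. \<forall>s t. 0 \<le> s \<and> s \<le> t \<and> t \<le> T \<and> ?S t - ?S s < \<delta> \<longrightarrow>
        \<bar>h t - h s\<bar> \<le> \<epsilon> * (?S t - ?S s)"
      using \<open>\<delta> > 0\<close> by blast
  qed
  then have "I T = G (?S T) - G 0" by (simp add: h_def I_def)
  with integrable_integral[OF intf] show ?thesis by (simp add: I_def)
qed

text \<open>The upper half rests on \<open>(1 - x + x^2) * (1 + x) = 1 + x^3\<close> and
  \<open>1 + x \<le> exp x\<close>. A quadratic remainder is negligible against the growth of the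
  clock.\<close>

lemma exp_neg_quadratic_bound:
  fixes x :: real
  assumes "0 \<le> x"
  shows "\<bar>1 - x - exp (- x)\<bar> \<le> x\<^sup>2"
proof -
  have "exp (- x) \<le> 1 - x + x\<^sup>2"
  proof -
    have "1 \<le> (1 - x + x\<^sup>2) * (1 + x)"
      using assms by (simp add: algebra_simps power2_eq_square)
    also have "\<dots> \<le> (1 - x + x\<^sup>2) * exp x"
    proof (rule mult_left_mono)
      have "0 \<le> (1 - x / 2)\<^sup>2 + 3 / 4 * x\<^sup>2" by simp
      then show "0 \<le> 1 - x + x\<^sup>2" by (simp add: power2_eq_square algebra_simps)
    qed simp
    finally show ?thesis by (simp add: exp_minus field_simps)
  qed
  with exp_ge_add_one_self[of "- x"] show ?thesis by simp
qed

text \<open>Integrating factor: \<open>f\<close> times \<open>exp (sigma_bar \<sigma>)\<close> has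
  increments of second order in the growth of \<open>sigma_bar \<sigma>\<close>, hence is constant.
  The bound by 1 is available because \<open>f\<close> will be the probability of a token.\<close>

lemma linear_integral_equation_solution:
  assumes int: "\<sigma> integrable_on {0..T}" and nonneg: "\<And>t. t \<in> {0..T} \<Longrightarrow> 0 \<le> \<sigma> t"
    and f: "\<And>t. t \<in> {0..T} \<Longrightarrow> ((\<lambda>u. - (f u * \<sigma> u)) has_integral (f t - f0)) {0..t}"
    and bounded: "\<And>t. t \<in> {0..T} \<Longrightarrow> \<bar>f t\<bar> \<le> 1"
    and t: "t \<in> {0..T}"
  shows "f t = f0 * exp (- sigma_bar \<sigma> t)"
proof -
  let ?S = "sigma_bar \<sigma>"
  define h where "h u = f u * exp (?S u)" for u
  have incr: "((\<lambda>u. f u * \<sigma> u) has_integral (f u - f v)) {u..v}" if uv: "0 \<le> u" "u \<le> v" "v \<le> T" for u v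
  proof -
    have i: "((\<lambda>u. f u * \<sigma> u) has_integral - (f w - f0)) {0..w}" if "w \<in> {0..T}" for w
      using has_integral_neg[OF f[OF that]] by simp
    have j: "(\<lambda>u. f u * \<sigma> u) integrable_on {0..v}" using i[of v] uv by auto
    then have k: "(\<lambda>u. f u * \<sigma> u) integrable_on {u..v}"
      by (rule integrable_on_subinterval) (use uv in auto)
    have "integral {0..u} (\<lambda>u. f u * \<sigma> u) + integral {u..v} (\<lambda>u. f u * \<sigma> u) = integral {0..v} (\<lambda>u. f u * \<sigma> u)"
      by (rule Henstock_Kurzweil_Integration.integral_combine) (use j uv in auto)
    moreover have "integral {0..u} (\<lambda>u. f u * \<sigma> u) = - (f u - f0)" "integral {0..v} (\<lambda>u. f u * \<sigma> u) = - (f v - f0)"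
      using i[of u] i[of v] uv by (auto simp: integral_unique)
    ultimately have "integral {u..v} (\<lambda>u. f u * \<sigma> u) = f u - f v" by simp
    with k show ?thesis by (metis integrable_integral)
  qed
  have "h t = h 0"
  proof (rule constant_if_increments_negligible[where S = ?S and h = h])
    show "0 \<le> t" using t by simp
    show "continuous_on {0..t} ?S"
      by (rule continuous_on_subset[OF continuous_on_sigma_bar[OF int]]) (use t in auto)
    show "?S u \<le> ?S v" if "0 \<le> u" "u \<le> v" "v \<le> t" for u v
      by (rule sigma_bar_mono[OF int nonneg]) (use t that in auto)
    fix \<epsilon> :: real assume "\<epsilon> > 0"
    define C where "C = 2 * exp (?S t)"
    have "C > 0" by (simp add: C_def)
    have "\<bar>h v - h u\<bar> \<le> \<epsilon> * (?S v - ?S u)"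
      if uv: "0 \<le> u" "u \<le> v" "v \<le> t" and d: "?S v - ?S u < \<epsilon> / C" for u v
    proof -
      define \<Delta> where "\<Delta> = ?S v - ?S u"
      have T: "v \<le> T" using uv t by simp
      have \<Delta>: "\<Delta> \<ge> 0" unfolding \<Delta>_def using sigma_bar_mono[OF int nonneg uv(1,2)] T by simp
      have \<sigma>: "(\<sigma> has_integral (?S w - ?S u)) {u..w}" if "w \<in> {u..v}" for w
        by (rule sigma_bar_diff[OF int]) (use uv T that in auto)
      \<comment> \<open>Bootstrapping: the crude bound on \<open>f\<close> shows that
        \<open>f\<close> varies by at most \<Delta>; fed back into the integral equation, this
        leaves an error of order \<Delta> squared.\<close>
      have near: "\<bar>f w - f u\<bar> \<le> \<Delta>" if w: "w \<in> {u..v}" for w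
      proof -
        have "\<bar>f u - f w\<bar> \<le> 1 * (?S w - ?S u)"
          by (rule has_integral_weighted_bound[OF incr \<sigma>]) (use nonneg bounded uv T w in auto)
        also have "\<dots> \<le> \<Delta>" unfolding \<Delta>_def using sigma_bar_mono[OF int nonneg, of w v] uv T w by simp
        finally show ?thesis by (simp add: abs_minus_commute)
      qed
      have "((\<lambda>w. f w * \<sigma> w - f u * \<sigma> w) has_integral (f u - f v) - f u * \<Delta>) {u..v}"
        unfolding \<Delta>_def by (intro has_integral_diff[OF incr] has_integral_mult_right \<sigma>) (use uv T in auto)
      then have "((\<lambda>w. (f w - f u) * \<sigma> w) has_integral (f u - f v) - f u * \<Delta>) {u..v}"
        by (simp add: algebra_simps)
      then have 1: "\<bar>(f u - f v) - f u * \<Delta>\<bar> \<le> \<Delta> * (?S v - ?S u)"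
        by (rule has_integral_weighted_bound[OF _ \<sigma>]) (use nonneg near uv T in auto)
      have 2: "\<bar>f u * (1 - \<Delta> - exp (- \<Delta>))\<bar> \<le> 1 * \<Delta>\<^sup>2"
        unfolding abs_mult
        by (rule mult_mono) (use bounded[of u] exp_neg_quadratic_bound[OF \<Delta>] uv T in auto)
      have "h v - h u = exp (?S v) * (f v - f u * exp (- \<Delta>))"
        by (simp add: h_def \<Delta>_def algebra_simps flip: exp_add)
      also have "\<bar>\<dots>\<bar> = exp (?S v) * \<bar>f v - f u * exp (- \<Delta>)\<bar>" by (simp add: abs_mult)
      also have "\<dots> \<le> exp (?S t) * (2 * \<Delta>\<^sup>2)"
      proof (rule mult_mono)
        show "exp (?S v) \<le> exp (?S t)" using sigma_bar_mono[OF int nonneg, of v t] uv t by simp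
        have "f v - f u * exp (- \<Delta>) = f u * (1 - \<Delta> - exp (- \<Delta>)) - ((f u - f v) - f u * \<Delta>)"
          by (simp add: algebra_simps)
        then show "\<bar>f v - f u * exp (- \<Delta>)\<bar> \<le> 2 * \<Delta>\<^sup>2"
          using 1 2 by (simp add: \<Delta>_def power2_eq_square)
      qed simp_all
      also have "\<dots> = (C * \<Delta>) * \<Delta>" by (simp add: C_def power2_eq_square)
      also have "\<dots> \<le> \<epsilon> * \<Delta>"
        by (rule mult_right_mono[OF _ \<Delta>]) (use d \<open>C > 0\<close> in \<open>simp add: \<Delta>_def field_simps\<close>)
      finally show ?thesis by (simp add: \<Delta>_def)
    qed
    then show "\<exists>\<delta>>0. \<forall>u v. 0 \<le> u \<and> u \<le> v \<and> v \<le> t \<and> ?S v - ?S u < \<delta> \<longrightarrow>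
        \<bar>h v - h u\<bar> \<le> \<epsilon> * (?S v - ?S u)"
      using \<open>\<epsilon> > 0\<close> \<open>C > 0\<close> by (meson divide_pos_pos)
  qed
  moreover have "f 0 = f0" using integral_unique[OF f[of 0]] t by simp
  ultimately show ?thesis by (simp add: h_def exp_minus field_simps)
qed

section \<open>Counting orders by prefix set and successor\<close>

text \<open>Bijections between the prefixes, the successors and the remainders glue to one
  permutation; the remainders have equal size because the prefixes do. The symmetric group thus acts
  transitively on flags of a given size.\<close>

lemma exists_permutes_flag:
  assumes "finite A" "U \<subseteq> A" "U' \<subseteq> A" "card U = card U'" "i \<in> A - U" "i' \<in> A - U'"
  obtains \<rho> where "\<rho> permutes A" "\<rho> ` U = U'" "\<rho> i = i'"
proof -
  have fin: "finite U" "finite U'" using assms(1-3) finite_subset by auto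
  obtain f where f: "bij_betw f U U'"
    using finite_same_card_bij[OF fin assms(4)] by blast
  have "card (A - insert i U) = card (A - insert i' U')"
    using assms fin by (simp add: card_Diff_subset)
  then obtain g where g: "bij_betw g (A - insert i U) (A - insert i' U')"
    using finite_same_card_bij[of "A - insert i U" "A - insert i' U'"] assms(1) by auto
  define \<rho> where "\<rho> x = (if x \<in> U then f x else if x = i then i' else if x \<in> A then g x else x)" for x
  have U: "bij_betw \<rho> U U'"
    using f bij_betw_cong[of U \<rho> f U'] by (simp add: \<rho>_def)
  have i: "bij_betw \<rho> {i} {i'}" using assms(5) by (auto simp: bij_betw_def \<rho>_def)
  have rest: "bij_betw \<rho> (A - insert i U) (A - insert i' U')"
    using g bij_betw_cong[of "A - insert i U" \<rho> g] by (simp add: \<rho>_def)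
  have "bij_betw \<rho> (U \<union> {i} \<union> (A - insert i U)) (U' \<union> {i'} \<union> (A - insert i' U'))"
    by (rule bij_betw_combine[OF bij_betw_combine[OF U i] rest]) (use assms in auto)
  moreover have "U \<union> {i} \<union> (A - insert i U) = A" "U' \<union> {i'} \<union> (A - insert i' U') = A"
    using assms by auto
  ultimately have "\<rho> permutes A"
    by (intro bij_imp_permutes) (use assms in \<open>auto simp: \<rho>_def\<close>)
  moreover have "\<rho> ` U = U'" using U by (simp add: bij_betw_def)
  moreover have "\<rho> i = i'" using assms(5) by (simp add: \<rho>_def)
  ultimately show thesis by (rule that)
qed

text \<open>A flag holds all that the term at place \<open>k + 1\<close> of an order depends on: the
  set of the first \<open>k\<close> positions, without their arrangement, and the next
  position.\<close>

definition flags :: "'a set \<Rightarrow> nat \<Rightarrow> ('a set \<times> 'a) set" where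
  "flags A k = (SIGMA U:{U. U \<subseteq> A \<and> card U = k}. A - U)"

lemma finite_flags: "finite A \<Longrightarrow> finite (flags A k)"
  unfolding flags_def by (intro finite_SigmaI) auto

lemma card_flags:
  assumes "finite A"
  shows "card (flags A k) = (card A choose k) * (card A - k)"
proof -
  have "card (flags A k) = (\<Sum>U\<in>{U. U \<subseteq> A \<and> card U = k}. card (A - U))"
    unfolding flags_def using assms by (intro card_SigmaI) auto
  also have "\<dots> = (\<Sum>U\<in>{U. U \<subseteq> A \<and> card U = k}. card A - k)"
    using assms by (intro sum.cong) (auto simp: card_Diff_subset finite_subset)
  finally show ?thesis using n_subsets[OF assms, of k] by simp
qed

lemma flag_of_order_in_flags:
  assumes "\<pi> permutes {1..d}" "l \<in> {1..d}"
  shows "(\<pi> ` {1..<l}, \<pi> l) \<in> flags {1..d} (l - 1)"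
proof -
  have inj: "inj \<pi>" using assms(1) by (rule permutes_inj)
  then have "card (\<pi> ` {1..<l}) = l - 1" by (simp add: card_image[OF inj_on_subset[OF inj subset_UNIV]])
  moreover have "\<pi> l \<in> {1..d}" "\<pi> ` {1..<l} \<subseteq> {1..d}"
    using permutes_image[OF assms(1)] assms(2) by fastforce+
  moreover have "\<pi> l \<notin> \<pi> ` {1..<l}" by (auto simp: inj_eq[OF inj])
  ultimately show ?thesis by (simp add: flags_def)
qed

text \<open>
  Composition with a permutation carrying one flag to another shows that all flags of the same size
  are hit equally often; the common value is found by dividing the number of permutations by the
  number of flags.
\<close>

lemma card_orders_with_flag:
  assumes l: "l \<in> {1..d}" and flag: "(U, i) \<in> flags {1..d} (l - 1)"
  shows "card {\<pi>. \<pi> permutes {1..d} \<and> (\<pi> ` {1..<l}, \<pi> l) = (U, i)} = fact (l - 1) * fact (d - l)"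
proof -
  define orders where "orders y = {\<pi>. \<pi> permutes {1..d} \<and> (\<pi> ` {1..<l}, \<pi> l) = y}" for y
  have fin: "finite (orders y)" for y
    unfolding orders_def by (rule finite_subset[OF _ finite_permutations[of "{1..d}"]]) auto
  have le: "card (orders y) \<le> card (orders z)"
    if y: "y \<in> flags {1..d} (l - 1)" and z: "z \<in> flags {1..d} (l - 1)" for y z
  proof -
    obtain V j W k where yz: "y = (V, j)" "z = (W, k)" by (cases y, cases z)
    obtain \<rho> where \<rho>: "\<rho> permutes {1..d}" "\<rho> ` V = W" "\<rho> j = k"
      by (rule exists_permutes_flag[of "{1..d}" V W j k]) (use y z in \<open>auto simp: flags_def yz\<close>)
    show ?thesis
    proof (rule card_inj_on_le[of "\<lambda>\<pi>. \<rho> \<circ> \<pi>"])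
      show "inj_on (\<lambda>\<pi>. \<rho> \<circ> \<pi>) (orders y)"
        by (auto simp: inj_on_def fun_eq_iff inj_eq[OF permutes_inj[OF \<rho>(1)]])
      show "(\<lambda>\<pi>. \<rho> \<circ> \<pi>) ` orders y \<subseteq> orders z"
        using \<rho> permutes_compose[OF _ \<rho>(1)] by (auto simp: orders_def yz image_comp[symmetric])
      show "finite (orders z)" by (rule fin)
    qed
  qed
  have "fact d = (\<Sum>\<pi>\<in>{\<pi>. \<pi> permutes {1..d}}. 1 :: nat)"
    using card_permutations[of "{1..d}" d] by simp
  also have "\<dots> = (\<Sum>y\<in>flags {1..d} (l - 1). \<Sum>\<pi>\<in>{\<pi> \<in> {\<pi>. \<pi> permutes {1..d}}. (\<pi> ` {1..<l}, \<pi> l) = y}. 1)"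
    using flag_of_order_in_flags[OF _ l]
    by (intro sum.group[symmetric] finite_permutations finite_flags) auto
  also have "\<dots> = (\<Sum>y\<in>flags {1..d} (l - 1). card (orders y))"
    by (simp add: orders_def)
  also have "\<dots> = (\<Sum>y\<in>flags {1..d} (l - 1). card (orders (U, i)))"
    by (intro sum.cong refl antisym le flag)
  also have "\<dots> = (d choose (l - 1)) * (d - (l - 1)) * card (orders (U, i))"
    by (simp add: card_flags)
  finally have "fact d = (d choose (l - 1)) * (d - (l - 1)) * card (orders (U, i))" .
  moreover have "fact d = (d choose (l - 1)) * (d - (l - 1)) * (fact (l - 1) * fact (d - l))"
  proof -
    have "d - (l - 1) = Suc (d - l)" using l by auto
    then have "fact (d - (l - 1)) = (d - (l - 1)) * (fact (d - l) :: nat)" by simp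
    moreover have "fact d = fact (l - 1) * fact (d - (l - 1)) * (d choose (l - 1))"
      by (rule binomial_fact_lemma[symmetric]) (use l in auto)
    ultimately show ?thesis by (simp add: ac_simps)
  qed
  moreover have "(d choose (l - 1)) * (d - (l - 1)) > 0" using l by auto
  ultimately show ?thesis unfolding orders_def by simp
qed

text \<open>Orders are grouped by their flag at place \<open>l\<close>. The place is recovered as
  \<open>card U + 1\<close>, so the sums over places and flags merge into one sum over all pairs,
  with the number of orders through a flag as coefficient.\<close>

lemma sum_orders_prefix:
  fixes g :: "nat set \<Rightarrow> nat \<Rightarrow> real"
  shows "(\<Sum>\<pi> | \<pi> permutes {1..d}. \<Sum>l=1..d. g (\<pi> ` {1..<l}) (\<pi> l)) =
    (\<Sum>U\<in>Pow {1..d}. \<Sum>i\<in>{1..d} - U. fact (card U) * fact (d - card U - 1) * g U i)"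
proof -
  let ?P = "{\<pi>. \<pi> permutes {1..d}}"
  let ?h = "\<lambda>(U, i). fact (card U) * fact (d - card U - 1) * g U i"
  let ?F = "SIGMA U:Pow {1..d}. {1..d} - U"
  have "(\<Sum>\<pi>\<in>?P. \<Sum>l=1..d. g (\<pi> ` {1..<l}) (\<pi> l)) = (\<Sum>l=1..d. \<Sum>\<pi>\<in>?P. g (\<pi> ` {1..<l}) (\<pi> l))"
    by (rule sum.swap)
  also have "\<dots> = (\<Sum>l=1..d. \<Sum>y\<in>{y \<in> ?F. card (fst y) + 1 = l}. ?h y)"
  proof (rule sum.cong)
    fix l assume l: "l \<in> {1..d}"
    have "(\<Sum>\<pi>\<in>?P. g (\<pi> ` {1..<l}) (\<pi> l)) =
        (\<Sum>y\<in>flags {1..d} (l - 1). \<Sum>\<pi>\<in>{\<pi> \<in> ?P. (\<pi> ` {1..<l}, \<pi> l) = y}. g (\<pi> ` {1..<l}) (\<pi> l))"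
      using flag_of_order_in_flags[OF _ l]
      by (intro sum.group[symmetric] finite_permutations finite_flags) auto
    also have "\<dots> = (\<Sum>y\<in>flags {1..d} (l - 1). ?h y)"
    proof (rule sum.cong)
      fix y assume y: "y \<in> flags {1..d} (l - 1)"
      obtain U i where [simp]: "y = (U, i)" by (cases y)
      have "(\<Sum>\<pi>\<in>{\<pi> \<in> ?P. (\<pi> ` {1..<l}, \<pi> l) = y}. g (\<pi> ` {1..<l}) (\<pi> l)) =
          (\<Sum>\<pi>\<in>{\<pi> \<in> ?P. (\<pi> ` {1..<l}, \<pi> l) = y}. g U i)"
        by (intro sum.cong) auto
      also have "\<dots> = real (card {\<pi>. \<pi> permutes {1..d} \<and> (\<pi> ` {1..<l}, \<pi> l) = (U, i)}) * g U i"
        by simp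
      also have "\<dots> = fact (l - 1) * fact (d - l) * g U i"
        using card_orders_with_flag[OF l, of U i] y by simp
      also have "\<dots> = ?h y" using y l by (auto simp: flags_def)
      finally show "(\<Sum>\<pi>\<in>{\<pi> \<in> ?P. (\<pi> ` {1..<l}, \<pi> l) = y}. g (\<pi> ` {1..<l}) (\<pi> l)) = ?h y" .
    qed simp
    also have "flags {1..d} (l - 1) = {y \<in> ?F. card (fst y) + 1 = l}"
      using l by (auto simp: flags_def)
    finally show "(\<Sum>\<pi>\<in>?P. g (\<pi> ` {1..<l}) (\<pi> l)) = (\<Sum>y\<in>{y \<in> ?F. card (fst y) + 1 = l}. ?h y)" .
  qed simp
  also have "\<dots> = (\<Sum>y\<in>?F. ?h y)"
  proof (rule sum.group)
    show "(\<lambda>y. card (fst y) + 1) ` ?F \<subseteq> {1..d}"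
    proof safe
      fix U i assume "U \<subseteq> {1..d}" "i \<in> {1..d}" "i \<notin> U"
      then have "card U < card {1..d}" by (intro psubset_card_mono) auto
      then show "card (fst (U, i)) + 1 \<in> {1..d}" by simp
    qed
  qed auto
  also have "\<dots> = (\<Sum>U\<in>Pow {1..d}. \<Sum>i\<in>{1..d} - U. fact (card U) * fact (d - card U - 1) * g U i)"
    by (subst sum.Sigma) auto
  finally show ?thesis .
qed

text \<open>Common unit of both losses: the network sees the same input whether exactly the
  positions \<open>U\<close> have survived the noise or have been revealed by an order.\<close>

definition token_nll :: "nat \<Rightarrow> nat \<Rightarrow> (tokseq \<Rightarrow> nat \<Rightarrow> nat \<Rightarrow> real) \<Rightarrow> tokseq \<Rightarrow> nat set \<Rightarrow> nat \<Rightarrow> real" where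
  "token_nll N d c x0 U i = - ln (c (keep_only N d U x0) i (x0 i))"

lemma ao_loss_eq:
  "ao_loss N d c x0 = (\<Sum>U\<in>Pow {1..d}. \<Sum>i\<in>{1..d} - U.
     token_nll N d c x0 U i * (fact (card U) * fact (d - card U - 1) / fact d))"
proof -
  have "{\<pi>. \<pi> permutes {1..d}} \<noteq> {}" using permutes_id by blast
  then have "ao_loss N d c x0 = (\<Sum>\<pi> | \<pi> permutes {1..d}. \<Sum>l=1..d.
      token_nll N d c x0 (\<pi> ` {1..<l}) (\<pi> l)) / fact d"
    using card_permutations[of "{1..d}" d] unfolding ao_loss_def
    by (subst integral_pmf_of_set) (simp_all add: finite_permutations token_nll_def model_cond_def)
  also have "\<dots> = (\<Sum>U\<in>Pow {1..d}. \<Sum>i\<in>{1..d} - U.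
     token_nll N d c x0 U i * (fact (card U) * fact (d - card U - 1) / fact d))"
    unfolding sum_orders_prefix by (simp add: sum_divide_distrib mult.commute)
  finally show ?thesis .
qed

section \<open>Beta integrals of the noise weights\<close>

lemma integral_beta_nat:
  "integral {0..1} (\<lambda>a :: real. a ^ k * (1 - a) ^ m) = fact k * fact m / fact (k + m + 1)"
proof -
  have "((\<lambda>a :: real. a powr (real (k + 1) - 1) * (1 - a) powr (real (m + 1) - 1)) has_integral
      Beta (real (k + 1)) (real (m + 1))) {0..1}"
    by (rule has_integral_Beta_real) auto
  \<comment> \<open>At the endpoints \<open>0 powr 0 = 0\<close> differs from
    \<open>0 ^ 0 = 1\<close>, so these two points are removed.\<close>
  then have "((\<lambda>a :: real. a ^ k * (1 - a) ^ m) has_integral Beta (real (k + 1)) (real (m + 1))) {0..1}"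
    by (rule has_integral_spike_finite[of "{0, 1}", rotated 2]) (auto simp: powr_realpow)
  moreover have "Beta (real (k + 1)) (real (m + 1)) = fact k * fact m / fact (k + m + 1)"
    using Gamma_fact[of k, where 'a = real] Gamma_fact[of m, where 'a = real]
      Gamma_fact[of "k + m + 1", where 'a = real]
    by (simp add: Beta_def add_ac)
  ultimately show ?thesis by (simp add: integral_unique)
qed

text \<open>
  While no noise has been added, states with a masked token have probability 0 and the loss integrand
  vanishes, but its closed form need not: for \<open>|U| = d - 1\<close> the factor \<open>(1 - a) ^ (d - |U| - 1)\<close>
  is \<open>0 ^ 0 = 1\<close>.
\<close>

lemma has_integral_zero_before_noise:
  fixes f G :: "real \<Rightarrow> real"
  assumes "0 \<le> T" and int: "\<sigma> integrable_on {0..T}" and nonneg: "\<And>t. t \<in> {0..T} \<Longrightarrow> 0 \<le> \<sigma> t"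
    and f: "\<And>s. s \<in> {0..T} \<Longrightarrow> (f has_integral G (sigma_bar \<sigma> s)) {0..s}"
    and "G 0 = 0"
  shows "((\<lambda>t. if sigma_bar \<sigma> t = 0 then 0 else f t) has_integral G (sigma_bar \<sigma> T)) {0..T}"
proof -
  let ?Z = "{t \<in> {0..T}. sigma_bar \<sigma> t = 0}"
  \<comment> \<open>Compactness yields the last noise-free time \<open>s\<close>. By monotonicity
    all of \<open>{0..s}\<close> is noise-free; beyond \<open>s\<close> the case distinction is
    idle, and the integral of \<open>f\<close> up to \<open>s\<close> is
    \<open>G 0 = 0\<close>.\<close>
  have "closed ?Z"
    using continuous_closed_preimage_constant[OF continuous_on_sigma_bar[OF int]] by simp
  moreover have "bounded ?Z" by (rule bounded_subset[of "{0..T}"]) auto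
  ultimately have "compact ?Z" by (simp add: compact_eq_bounded_closed)
  moreover have "0 \<in> ?Z" using \<open>0 \<le> T\<close> by simp
  ultimately obtain s where s: "s \<in> ?Z" and sup: "\<And>t. t \<in> ?Z \<Longrightarrow> t \<le> s"
    using compact_attains_sup[of ?Z] by blast
  have zero: "sigma_bar \<sigma> t = 0" if "t \<in> {0..s}" for t
    using sigma_bar_mono[OF int nonneg, of t s] sigma_bar_nonneg[OF int nonneg, of t] that s by auto
  have "((\<lambda>t. if sigma_bar \<sigma> t = 0 then 0 else f t) has_integral 0) {0..s}"
    by (rule has_integral_is_0) (use zero in auto)
  moreover have "((\<lambda>t. if sigma_bar \<sigma> t = 0 then 0 else f t) has_integral G (sigma_bar \<sigma> T)) {s..T}"
  proof (rule has_integral_spike_finite[of "{s}"])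
    have "f integrable_on {0..T}" using f[of T] \<open>0 \<le> T\<close> by auto
    then have "f integrable_on {s..T}" by (rule integrable_on_subinterval) (use s in auto)
    moreover have "integral {0..s} f + integral {s..T} f = integral {0..T} f"
      by (rule Henstock_Kurzweil_Integration.integral_combine)
        (use s \<open>f integrable_on {0..T}\<close> in auto)
    moreover have "integral {0..s} f = 0" "integral {0..T} f = G (sigma_bar \<sigma> T)"
      using f[of s] f[of T] s \<open>0 \<le> T\<close> \<open>G 0 = 0\<close> by (auto simp: integral_unique)
    ultimately show "(f has_integral G (sigma_bar \<sigma> T)) {s..T}"
      by (metis add_0 integrable_integral)
    show "(if sigma_bar \<sigma> t = 0 then 0 else f t) = f t" if "t \<in> {s..T} - {s}" for t
      using sup[of t] that s by auto
  qed simp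
  ultimately have "((\<lambda>t. if sigma_bar \<sigma> t = 0 then 0 else f t) has_integral
      (0 + G (sigma_bar \<sigma> T))) {0..T}"
    by (rule has_integral_combine[rotated 2]) (use s in auto)
  then show ?thesis by simp
qed

text \<open>An upper incomplete Beta integral. The lower limit varies because the survival
  probability falls from 1 at time 0 to its value \<open>x\<close> at the horizon.\<close>

definition beta_tail :: "nat \<Rightarrow> nat \<Rightarrow> real \<Rightarrow> real" where
  "beta_tail k m x = integral {x..1} (\<lambda>a. a ^ k * (1 - a) ^ m)"

lemma beta_tail_has_derivative:
  assumes "x \<in> {0..1}"
  shows "(beta_tail k m has_real_derivative - (x ^ k * (1 - x) ^ m)) (at x within {0..1})"
  unfolding beta_tail_def
  by (rule integral_has_real_derivative'[OF _ assms]) (intro continuous_intros)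

lemma beta_tail_tendsto:
  "(beta_tail k m \<longlongrightarrow> fact k * fact m / fact (k + m + 1)) (at_right 0)"
proof -
  have "continuous_on {0..1} (beta_tail k m)"
    using beta_tail_has_derivative by (rule DERIV_continuous_on)
  then have "(beta_tail k m \<longlongrightarrow> beta_tail k m 0) (at 0 within {0..1})"
    by (auto simp: continuous_on_def)
  then show ?thesis
    using integral_beta_nat[of k m] at_within_Icc_at_right[of 0 "1 :: real"] by (simp add: beta_tail_def)
qed

text \<open>Formally \<open>a t * \<sigma> t\<close> is the negative differential of
  \<open>a t\<close>, and the variable lower limit of \<open>beta_tail\<close> supplies the second
  sign. At time 0 the tail runs over a single point and contributes nothing.\<close>

lemma has_integral_noise_beta:
  assumes "0 \<le> T" and int: "\<sigma> integrable_on {0..T}" and nonneg: "\<And>t. t \<in> {0..T} \<Longrightarrow> 0 \<le> \<sigma> t"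
  defines "a \<equiv> \<lambda>t. exp (- sigma_bar \<sigma> t)"
  shows "((\<lambda>t. a t ^ k * (1 - a t) ^ m * a t * \<sigma> t) has_integral beta_tail k m (a T)) {0..T}"
proof -
  let ?\<phi> = "\<lambda>u :: real. exp (- u) ^ k * (1 - exp (- u)) ^ m * exp (- u)"
  have "((\<lambda>t. ?\<phi> (sigma_bar \<sigma> t) * \<sigma> t) has_integral
      beta_tail k m (exp (- sigma_bar \<sigma> T)) - beta_tail k m (exp (- 0))) {0..T}"
  proof (rule has_integral_substitution_sigma_bar[OF assms(1) int nonneg])
    show "continuous_on {0..sigma_bar \<sigma> T} ?\<phi>" by (intro continuous_intros)
    fix u assume u: "u \<in> {0..sigma_bar \<sigma> T}"
    let ?I = "{0..sigma_bar \<sigma> T}"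
    have "(beta_tail k m has_real_derivative - (exp (- u) ^ k * (1 - exp (- u)) ^ m))
        (at (exp (- u)) within (\<lambda>u. exp (- u)) ` ?I)"
      by (rule has_field_derivative_subset[OF beta_tail_has_derivative]) (use u in auto)
    moreover have "((\<lambda>u. exp (- u)) has_real_derivative - exp (- u)) (at u within ?I)"
      by (auto intro!: derivative_eq_intros)
    ultimately have "(beta_tail k m \<circ> (\<lambda>u. exp (- u)) has_real_derivative
        - (exp (- u) ^ k * (1 - exp (- u)) ^ m) * - exp (- u)) (at u within ?I)"
      by (rule DERIV_image_chain)
    then show "((\<lambda>u. beta_tail k m (exp (- u))) has_real_derivative ?\<phi> u) (at u within ?I)"
      by (simp add: o_def)
  qed
  then show ?thesis by (simp add: a_def beta_tail_def)
qed

section \<open>Law of the noised sequence\<close>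

text \<open>The kernel \<open>P\<close> is only known to exist. Since the chain starts almost surely
  in \<open>x\<close>, the joint law at times \<open>0\<close> and \<open>u\<close> identifies the
  row \<open>P 0 u x\<close> with the law of \<open>X u\<close>, and the forward equation passes to
  that law.\<close>

lemma ctmc_marginal_forward:
  assumes ctmc: "ctmc M S R T X" and x: "x \<in> S" and init: "AE \<omega> in M. X 0 \<omega> = x"
    and t: "t \<in> {0..T}" and y: "y \<in> S"
  shows "((\<lambda>u. \<Sum>z\<in>S. \<P>(\<omega> in M. X u \<omega> = z) * R u z y) has_integral
    (\<P>(\<omega> in M. X t \<omega> = y) - of_bool (x = y))) {0..t}"
proof -
  interpret prob_space M using ctmc by (simp add: ctmc_def)
  obtain P where fwd: "forward_equation S R T P"
    and fdd: "\<forall>(n::nat) ts xs. (\<forall>k\<le>n. ts k \<in> {0..T} \<and> xs k \<in> S) \<and> (\<forall>k<n. ts k \<le> ts (Suc k)) \<longrightarrow>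
           \<P>(\<omega> in M. \<forall>k\<le>n. X (ts k) \<omega> = xs k) =
           \<P>(\<omega> in M. X (ts 0) \<omega> = xs 0) * (\<Prod>k<n. P (ts k) (ts (Suc k)) (xs k) (xs (Suc k)))"
    using ctmc unfolding ctmc_def by blast
  have [measurable]: "Measurable.pred M (\<lambda>\<omega>. X u \<omega> = z)" if "u \<in> {0..T}" "z \<in> S" for u z
  proof -
    have "X u \<in> M \<rightarrow>\<^sub>M count_space S" using ctmc that by (simp add: ctmc_def)
    from measurable_sets[OF this, of "{z}"] that have "X u -` {z} \<inter> space M \<in> sets M" by simp
    then show ?thesis by (simp add: pred_def vimage_def Int_def conj_commute)
  qed
  have T: "0 \<in> {0..T}" using t by simp
  have transition: "P 0 u x z = \<P>(\<omega> in M. X u \<omega> = z)" if u: "u \<in> {0..T}" and z: "z \<in> S" for u z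
  proof -
    have two: "(\<forall>k\<le>(1::nat). Q k) \<longleftrightarrow> Q 0 \<and> Q 1" for Q by (auto simp: le_Suc_eq)
    have "\<P>(\<omega> in M. X 0 \<omega> = x \<and> X u \<omega> = z) = \<P>(\<omega> in M. X 0 \<omega> = x) * P 0 u x z"
      using fdd[rule_format, of 1 "\<lambda>k. if k = 0 then 0 else u" "\<lambda>k. if k = 0 then x else z"] u z x
      unfolding two by simp
    moreover have "\<P>(\<omega> in M. X 0 \<omega> = x) = 1"
      using init T x by (subst prob_Collect_eq_1) auto
    moreover have "\<P>(\<omega> in M. X 0 \<omega> = x \<and> X u \<omega> = z) = \<P>(\<omega> in M. X u \<omega> = z)"
      by (rule finite_measure_eq_AE) (use init T x u z in \<open>auto simp: pred_def[symmetric]\<close>)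
    ultimately show ?thesis by simp
  qed
  have "((\<lambda>u. \<Sum>z\<in>S. P 0 u x z * R u z y) has_integral (P 0 t x y - of_bool (x = y))) {0..t}"
    using fwd t x y unfolding forward_equation_def by auto
  then show ?thesis
    unfolding transition[OF t y]
    by (rule has_integral_eq[rotated]) (use transition t in \<open>auto intro!: sum.cong\<close>)
qed

text \<open>\<open>a\<close> is the survival probability and \<open>z\<close> is meant to be a clean
  token; from the mask the law would be concentrated on \<open>N\<close>.\<close>

definition absorb_kernel :: "nat \<Rightarrow> real \<Rightarrow> nat \<Rightarrow> nat \<Rightarrow> real" where
  "absorb_kernel N a z y = (if y = N then 1 - a else if y = z then a else 0)"

text \<open>No transition enters an unmasked token, so its column of the rate matrix has the single
  entry -1 on the diagonal and the forward equation decouples into scalar linear ones. The mask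
  receives the remaining mass.\<close>

lemma absorbing_marginal:
  assumes ctmc: "ctmc M {1..N} (\<lambda>t x y. \<sigma> t * Q_absorb N x y) T X"
    and z: "z \<in> {1..<N}" and init: "AE \<omega> in M. X 0 \<omega> = z"
    and int: "\<sigma> integrable_on {0..T}" and nonneg: "\<And>t. t \<in> {0..T} \<Longrightarrow> 0 \<le> \<sigma> t"
    and t: "t \<in> {0..T}" and y: "y \<in> {1..N}"
  shows "\<P>(\<omega> in M. X t \<omega> = y) = absorb_kernel N (exp (- sigma_bar \<sigma> t)) z y"
proof -
  interpret prob_space M using ctmc by (simp add: ctmc_def)
  have unmasked: "\<P>(\<omega> in M. X t \<omega> = y) = of_bool (z = y) * exp (- sigma_bar \<sigma> t)" if y: "y \<in> {1..<N}" for y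
  proof (rule linear_integral_equation_solution[OF int nonneg _ _ t])
    fix u assume u: "u \<in> {0..T}"
    have "(\<Sum>w = 1..N. \<P>(\<omega> in M. X v \<omega> = w) * (\<sigma> v * Q_absorb N w y)) =
        (\<Sum>w = 1..N. if w = y then - (\<P>(\<omega> in M. X v \<omega> = y) * \<sigma> v) else 0)" for v
      by (rule sum.cong) (use y in \<open>auto simp: Q_absorb_def\<close>)
    also have "(\<Sum>w = 1..N. if w = y then - (\<P>(\<omega> in M. X v \<omega> = y) * \<sigma> v) else 0) =
        - (\<P>(\<omega> in M. X v \<omega> = y) * \<sigma> v)" for v
      using y by (subst sum.delta) auto
    finally show "((\<lambda>v. - (\<P>(\<omega> in M. X v \<omega> = y) * \<sigma> v)) has_integral
        (\<P>(\<omega> in M. X u \<omega> = y) - of_bool (z = y))) {0..u}"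
      using ctmc_marginal_forward[OF ctmc _ init u, of y] y z by simp
  qed simp_all
  show ?thesis
  proof (cases "y = N")
    case False
    then show ?thesis using unmasked[of y] y by (auto simp: absorb_kernel_def)
  next
    case True
    have X: "X t \<in> M \<rightarrow>\<^sub>M count_space {1..N}" using ctmc t by (simp add: ctmc_def)
    have "1 = prob (\<Union>w\<in>{1..N}. {\<omega> \<in> space M. X t \<omega> = w})"
    proof -
      have "(\<Union>w\<in>{1..N}. {\<omega> \<in> space M. X t \<omega> = w}) = space M"
        using measurable_space[OF X] by auto
      then show ?thesis by (simp add: prob_space)
    qed
    also have "\<dots> = (\<Sum>w = 1..N. \<P>(\<omega> in M. X t \<omega> = w))"
    proof (rule finite_measure_finite_Union)
      show "(\<lambda>w. {\<omega> \<in> space M. X t \<omega> = w}) ` {1..N} \<subseteq> sets M"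
      proof safe
        fix w assume "w \<in> {1..N}"
        from measurable_sets[OF X, of "{w}"] this have "X t -` {w} \<inter> space M \<in> sets M" by simp
        then show "{\<omega> \<in> space M. X t \<omega> = w} \<in> sets M" by (simp add: vimage_def Int_def conj_commute)
      qed
    qed (auto simp: disjoint_family_on_def)
    also have "\<dots> = \<P>(\<omega> in M. X t \<omega> = N) + (\<Sum>w = 1..<N. \<P>(\<omega> in M. X t \<omega> = w))"
      using z by (simp add: atLeastLessThanSuc_atLeastAtMost[symmetric])
    also have "(\<Sum>w = 1..<N. \<P>(\<omega> in M. X t \<omega> = w)) = (\<Sum>w = 1..<N. if w = z then exp (- sigma_bar \<sigma> t) else 0)"
      by (rule sum.cong) (auto simp: unmasked)
    also have "\<dots> = exp (- sigma_bar \<sigma> t)" using z by (subst sum.delta) auto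
    finally show ?thesis by (simp add: True absorb_kernel_def)
  qed
qed

lemma marginal_forward_process:
  assumes clean: "x0 \<in> clean_seqs N d" and process: "forward_process M N d \<sigma> T x0 X"
    and int: "\<sigma> integrable_on {0..T}" and nonneg: "\<And>t. t \<in> {0..T} \<Longrightarrow> 0 \<le> \<sigma> t"
    and t: "t \<in> {0..T}" and x: "x \<in> seqs N d"
  shows "marginal M d X t x = (\<Prod>i=1..d. absorb_kernel N (exp (- sigma_bar \<sigma> t)) (x0 i) (x i))"
proof (cases "d = 0")
  \<comment> \<open>Without positions the intersection formed below would be the whole type instead
    of the sample space.\<close>
  case True
  interpret prob_space M using process by (simp add: forward_process_def)
  show ?thesis using True by (simp add: marginal_def prob_space)
next
  case False
  interpret prob_space M using process by (simp add: forward_process_def)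
  have "indep_vars (\<lambda>_. Pi\<^sub>M {0..T} (\<lambda>_. count_space {1..N})) (\<lambda>i \<omega>. \<lambda>t\<in>{0..T}. X i t \<omega>) {1..d}"
    using process by (simp add: forward_process_def)
  \<comment> \<open>Evaluation at \<open>t\<close> is a measurable function of the path, so
    independence passes from paths to tokens.\<close>
  then have "indep_vars (\<lambda>_. count_space {1..N}) (\<lambda>i \<omega>. (\<lambda>t\<in>{0..T}. X i t \<omega>) t) {1..d}"
    by (rule indep_vars_compose2) (use t in simp)
  then have indep: "indep_vars (\<lambda>_. count_space {1..N}) (\<lambda>i \<omega>. X i t \<omega>) {1..d}"
    using t by simp
  have "marginal M d X t x = prob (\<Inter>i\<in>{1..d}. X i t -` {x i} \<inter> space M)"
    unfolding marginal_def by (rule arg_cong[where f = prob]) (use False in auto)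
  also have "\<dots> = (\<Prod>i=1..d. prob (X i t -` {x i} \<inter> space M))"
    by (rule indep_varsD_finite[OF indep]) (use False x in \<open>auto simp: seqs_def\<close>)
  also have "\<dots> = (\<Prod>i=1..d. absorb_kernel N (exp (- sigma_bar \<sigma> t)) (x0 i) (x i))"
  proof (rule prod.cong)
    fix i assume i: "i \<in> {1..d}"
    have "x0 i \<in> {1..<N}" "x i \<in> {1..N}" using clean x i by (auto simp: clean_seqs_def seqs_def)
    moreover have "ctmc M {1..N} (\<lambda>t x y. \<sigma> t * Q_absorb N x y) T (X i)" "AE \<omega> in M. X i 0 \<omega> = x0 i"
      using process i by (auto simp: forward_process_def)
    ultimately have "\<P>(\<omega> in M. X i t \<omega> = x i) = absorb_kernel N (exp (- sigma_bar \<sigma> t)) (x0 i) (x i)"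
      using int nonneg t by (intro absorbing_marginal)
    then show "prob (X i t -` {x i} \<inter> space M) = absorb_kernel N (exp (- sigma_bar \<sigma> t)) (x0 i) (x i)"
      by (simp add: vimage_def Int_def conj_commute)
  qed simp
  finally show ?thesis .
qed

section \<open>Closed form of the score entropy integrand\<close>

lemma finite_seqs: "finite (seqs N d)"
  unfolding seqs_def by (intro finite_PiE) auto

text \<open>Every transition leads into the mask, so another state with nonzero rate into
  \<open>x\<close> arises from \<open>x\<close> by unmasking one position. Position and token list
  these states without repetition, because the entry changes from \<open>N\<close> to a different
  token.\<close>

lemma sum_Q_seq:
  assumes x: "x \<in> seqs N d"
  shows "(\<Sum>xh\<in>seqs N d - {x}. Q_seq N d \<sigma> t xh x * g xh) =
    (\<Sum>i | i \<in> {1..d} \<and> x i = N. \<Sum>j=1..<N. \<sigma> t * g (x(i := j)))"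
proof -
  define B where "B = {i \<in> {1..d}. x i = N} \<times> {1..<N}"
  define h where "h = (\<lambda>(i, j). x(i := j))"
  have inj: "inj_on h B"
  proof (rule inj_onI; clarify)
    fix i j i' j' assume B: "(i, j) \<in> B" "(i', j') \<in> B" and "h (i, j) = h (i', j')"
    then have "(x(i := j)) i = (x(i' := j')) i" by (simp add: h_def)
    with B have "i = i'" by (auto simp: B_def split: if_splits)
    moreover from this \<open>(x(i := j)) i = (x(i' := j')) i\<close> have "j = j'" by simp
    ultimately show "i = i' \<and> j = j'" by simp
  qed
  have image: "h ` B \<subseteq> seqs N d - {x}"
  proof clarify
    fix i j assume B: "(i, j) \<in> B"
    then have "(x(i := j)) i \<noteq> x i" by (auto simp: B_def)
    then have "x(i := j) \<noteq> x" by metis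
    moreover have "x(i := j) \<in> seqs N d"
      using x B by (auto simp: seqs_def B_def PiE_iff extensional_def)
    ultimately show "h (i, j) \<in> seqs N d - {x}" by (simp add: h_def)
  qed
  have off: "Q_seq N d \<sigma> t xh x = 0" if xh: "xh \<in> seqs N d - {x} - h ` B" for xh
    unfolding Q_seq_def
  proof (rule sum.neutral, rule ballI)
    fix i assume i: "i \<in> {1..d}"
    have "Q_absorb N (xh i) (x i) = 0" if eq: "\<forall>j\<in>{1..d} - {i}. xh j = x j"
    proof (rule ccontr)
      assume "Q_absorb N (xh i) (x i) \<noteq> 0"
      have xh': "xh = x(i := xh i)"
      proof
        fix j show "xh j = (x(i := xh i)) j"
          using eq x xh by (cases "j \<in> {1..d}") (auto simp: seqs_def PiE_iff extensional_def)
      qed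
      then have "xh i \<noteq> x i" using xh by (metis Diff_iff fun_upd_triv singletonI)
      then have "xh i \<noteq> N" "x i = N"
        using \<open>Q_absorb N (xh i) (x i) \<noteq> 0\<close> by (auto simp: Q_absorb_def split: if_splits)
      moreover have "xh i \<in> {1..N}" using xh i by (auto simp: seqs_def)
      ultimately have "(i, xh i) \<in> B" using i by (simp add: B_def)
      then have "h (i, xh i) \<in> h ` B" by (rule imageI)
      with xh' xh show False by (simp add: h_def)
    qed
    then show "(if \<forall>j\<in>{1..d} - {i}. xh j = x j then \<sigma> t * Q_absorb N (xh i) (x i) else 0) = 0"
      by simp
  qed
  have on: "Q_seq N d \<sigma> t (x(i := j)) x = \<sigma> t" if B: "(i, j) \<in> B" for i j
  proof -
    have i: "i \<in> {1..d}" "x i = N" "j \<noteq> N" using B by (auto simp: B_def)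
    have "Q_seq N d \<sigma> t (x(i := j)) x = (\<Sum>k=1..d. if k = i then \<sigma> t else 0)"
      unfolding Q_seq_def
    proof (rule sum.cong)
      fix k assume "k \<in> {1..d}"
      show "(if \<forall>l\<in>{1..d} - {k}. (x(i := j)) l = x l
          then \<sigma> t * Q_absorb N ((x(i := j)) k) (x k) else 0) = (if k = i then \<sigma> t else 0)"
      proof (cases "k = i")
        case True
        then show ?thesis using i by (simp add: Q_absorb_def)
      next
        case False
        then have "\<not> (\<forall>l\<in>{1..d} - {k}. (x(i := j)) l = x l)" using i by auto
        then show ?thesis unfolding if_not_P[OF False] by (rule if_not_P)
      qed
    qed simp
    also have "\<dots> = \<sigma> t" using i by (subst sum.delta) auto
    finally show ?thesis .
  qed
  have "(\<Sum>xh\<in>seqs N d - {x}. Q_seq N d \<sigma> t xh x * g xh) = (\<Sum>xh\<in>h ` B. Q_seq N d \<sigma> t xh x * g xh)"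
    by (rule sum.mono_neutral_right) (use image off finite_seqs in auto)
  also have "\<dots> = (\<Sum>y\<in>B. Q_seq N d \<sigma> t (h y) x * g (h y))"
    by (simp add: sum.reindex[OF inj])
  also have "\<dots> = (\<Sum>(i, j)\<in>B. \<sigma> t * g (x(i := j)))"
    by (rule sum.cong) (auto simp: h_def on)
  also have "\<dots> = (\<Sum>i | i \<in> {1..d} \<and> x i = N. \<Sum>j=1..<N. \<sigma> t * g (x(i := j)))"
    unfolding B_def by (rule sum.cartesian_product[symmetric])
  finally show ?thesis .
qed

lemma score_fun_upd:
  assumes "i \<in> {1..d}" "x i \<noteq> j"
  shows "score d c \<sigma> x t (x(i := j)) =
    exp (- sigma_bar \<sigma> t) / (1 - exp (- sigma_bar \<sigma> t)) * c x i j"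
proof -
  have "(THE k. k \<in> {1..d} \<and> (x(i := j)) k \<noteq> x k) = i"
    by (rule the_equality) (use assms in \<open>auto split: if_splits\<close>)
  then show ?thesis by (simp add: score_def)
qed

lemma softmax_network_positive:
  assumes "softmax_network N d c" "x \<in> seqs N d" "i \<in> {1..d}" "x i = N" "j \<in> {1..<N}"
  shows "0 < c x i j"
proof -
  obtain z where z: "\<forall>j\<in>{1..<N}. c x i j = softmax {1..<N} z j"
    using assms unfolding softmax_network_def by blast
  have "0 < (\<Sum>k\<in>{1..<N}. exp (z k))" by (rule sum_pos) (use assms in auto)
  then show ?thesis using z assms(5) by (simp add: softmax_def)
qed

lemma softmax_network_sum:
  assumes "softmax_network N d c" "x \<in> seqs N d" "i \<in> {1..d}" "x i = N" "N > 1"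
  shows "(\<Sum>j=1..<N. c x i j) = 1"
proof -
  obtain z where z: "\<forall>j\<in>{1..<N}. c x i j = softmax {1..<N} z j"
    using assms unfolding softmax_network_def by blast
  have pos: "0 < (\<Sum>k\<in>{1..<N}. exp (z k))" by (rule sum_pos) (use assms in auto)
  have "(\<Sum>j=1..<N. c x i j) = (\<Sum>j=1..<N. exp (z j) / (\<Sum>k=1..<N. exp (z k)))"
    by (rule sum.cong) (use z in \<open>auto simp: softmax_def\<close>)
  then show ?thesis using pos by (simp flip: sum_divide_distrib)
qed

text \<open>Only the true token \<open>z\<close> has a nonzero ratio, and \<open>K 0 = 0\<close>
  elsewhere. The total \<open>r\<close> of the scores cancels the \<open>- r\<close> in
  \<open>K r\<close>, and the \<open>r * ln r\<close> in \<open>K r\<close> cancels the contribution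
  of \<open>r\<close> to \<open>- r * ln (r * w z)\<close>.\<close>

lemma score_entropy_one_position:
  fixes w :: "nat \<Rightarrow> real"
  assumes "finite A" "z \<in> A" "\<And>j. j \<in> A \<Longrightarrow> 0 < w j" "sum w A = 1" "0 < r"
  shows "(\<Sum>j\<in>A. r * w j - (if j = z then r else 0) * ln (r * w j) + K (if j = z then r else 0)) =
    - (r * ln (w z))"
proof -
  have "(\<Sum>j\<in>A. r * w j - (if j = z then r else 0) * ln (r * w j) + K (if j = z then r else 0)) =
      (\<Sum>j\<in>A. r * w j + (if j = z then - r * ln (r * w z) + K r else 0))"
    by (rule sum.cong) (auto simp: K_def)
  also have "\<dots> = r * sum w A + (- r * ln (r * w z) + K r)"
    using assms(1,2) by (simp add: sum.distrib sum_distrib_left)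
  also have "ln (r * w z) = ln r + ln (w z)"
    using assms(3)[OF assms(2)] assms(5) by (intro ln_mult_pos) auto
  also have "r * sum w A + (- r * (ln r + ln (w z)) + K r) = - (r * ln (w z))"
    unfolding assms(4) K_def by (simp add: algebra_simps)
  finally show ?thesis .
qed

lemma keep_only_in_seqs:
  assumes "x0 \<in> clean_seqs N d"
  shows "keep_only N d U x0 \<in> seqs N d"
proof -
  have "x0 i \<in> {1..<N}" if "i \<in> {1..d}" for i using assms that by (auto simp: clean_seqs_def)
  then show ?thesis by (fastforce simp: keep_only_def seqs_def)
qed

lemma inj_on_keep_only:
  assumes "x0 \<in> clean_seqs N d"
  shows "inj_on (\<lambda>U. keep_only N d U x0) (Pow {1..d})"
proof (rule inj_on_inverseI)
  fix U assume "U \<in> Pow {1..d}"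
  moreover have "x0 i \<noteq> N" if "i \<in> {1..d}" for i using assms that by (force simp: clean_seqs_def)
  ultimately show "{i \<in> {1..d}. keep_only N d U x0 i \<noteq> N} = U"
    by (auto simp: keep_only_def)
qed

lemma dse_integrand_eq:
  assumes clean: "x0 \<in> clean_seqs N d" and network: "softmax_network N d c"
    and noise: "0 \<le> sigma_bar \<sigma> t"
    and p: "\<And>x. x \<in> seqs N d \<Longrightarrow>
      p t x = (\<Prod>i=1..d. absorb_kernel N (exp (- sigma_bar \<sigma> t)) (x0 i) (x i))"
  defines "a \<equiv> exp (- sigma_bar \<sigma> t)"
  shows "dse_integrand N d c \<sigma> p t = (if sigma_bar \<sigma> t = 0 then 0 else
    (\<Sum>U\<in>Pow {1..d}. \<Sum>i\<in>{1..d} - U.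
      token_nll N d c x0 U i * (a ^ card U * (1 - a) ^ (d - card U - 1) * a * \<sigma> t)))"
proof -
  let ?r = "a / (1 - a)"
  let ?masked = "\<lambda>x. {i. i \<in> {1..d} \<and> x i = N}"
  have x0: "x0 i \<in> {1..<N}" if "i \<in> {1..d}" for i using clean that by (auto simp: clean_seqs_def)
  have integrand: "dse_integrand N d c \<sigma> p t =
      (\<Sum>x\<in>seqs N d. p t x * (\<Sum>i\<in>?masked x. \<Sum>j=1..<N. \<sigma> t *
        (score d c \<sigma> x t (x(i := j)) - p t (x(i := j)) / p t x * ln (score d c \<sigma> x t (x(i := j)))
          + K (p t (x(i := j)) / p t x))))"
    unfolding dse_integrand_def by (rule sum.cong[OF refl], subst sum_Q_seq) simp_all
  show ?thesis
  proof (cases "sigma_bar \<sigma> t = 0")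
    case True
    \<comment> \<open>Without noise a mask contributes the factor \<open>1 - a = 0\<close>;
      sequences without a mask have an empty inner sum.\<close>
    have "p t x = 0" if x: "x \<in> seqs N d" and i: "i \<in> ?masked x" for x i
    proof -
      have "absorb_kernel N (exp (- sigma_bar \<sigma> t)) (x0 i) (x i) = 0"
        using i True by (simp add: absorb_kernel_def)
      moreover have "i \<in> {1..d}" using i by simp
      ultimately show ?thesis unfolding p[OF x] by (intro prod_zero) (simp, blast)
    qed
    then have "dse_integrand N d c \<sigma> p t = 0"
      unfolding integrand by (intro sum.neutral ballI) (metis (no_types, lifting) mult_eq_0_iff sum.neutral)
    then show ?thesis using True by simp
  next
    case False
    then have a: "0 < a" "a < 1" using noise by (auto simp: a_def)
    then have r: "0 < ?r" by simp
    let ?U = "\<lambda>U. keep_only N d U x0"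
    \<comment> \<open>For \<open>p t x = 0\<close> the quotients would collapse to 0 by convention;
      such states drop out later through their weight.\<close>
    have position: "(\<Sum>j=1..<N. \<sigma> t *
        (score d c \<sigma> x t (x(i := j)) - p t (x(i := j)) / p t x * ln (score d c \<sigma> x t (x(i := j)))
          + K (p t (x(i := j)) / p t x))) = \<sigma> t * - (?r * ln (c x i (x0 i)))"
      if x: "x \<in> seqs N d" and nz: "p t x \<noteq> 0" and i: "i \<in> ?masked x" for x i
    proof -
      have i': "i \<in> {1..d}" "x i = N" using i by auto
      have ratio: "p t (x(i := j)) / p t x = (if j = x0 i then ?r else 0)" if j: "j \<in> {1..<N}" for j
      proof -
        let ?rest = "\<Prod>k\<in>{1..d} - {i}. absorb_kernel N a (x0 k) (x k)"
        have "x(i := j) \<in> seqs N d"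
          using x i' j by (auto simp: seqs_def PiE_iff extensional_def)
        then have "p t (x(i := j)) = absorb_kernel N a (x0 i) j *
            (\<Prod>k\<in>{1..d} - {i}. absorb_kernel N a (x0 k) ((x(i := j)) k))"
          unfolding p[OF \<open>x(i := j) \<in> seqs N d\<close>] a_def[symmetric] using i' by (subst prod.remove[of _ i]) auto
        also have "(\<Prod>k\<in>{1..d} - {i}. absorb_kernel N a (x0 k) ((x(i := j)) k)) = ?rest"
          by (rule prod.cong) auto
        finally have 1: "p t (x(i := j)) = absorb_kernel N a (x0 i) j * ?rest" .
        have 2: "p t x = absorb_kernel N a (x0 i) (x i) * ?rest"
          unfolding p[OF x] a_def[symmetric] using i' by (subst prod.remove[of _ i]) auto
        from 2 nz have "?rest \<noteq> 0" by auto
        then show ?thesis unfolding 1 2 using i' j by (simp add: absorb_kernel_def)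
      qed
      have "(\<Sum>j=1..<N. \<sigma> t *
          (score d c \<sigma> x t (x(i := j)) - p t (x(i := j)) / p t x * ln (score d c \<sigma> x t (x(i := j)))
            + K (p t (x(i := j)) / p t x))) =
          (\<Sum>j=1..<N. \<sigma> t * (?r * c x i j - (if j = x0 i then ?r else 0) * ln (?r * c x i j)
            + K (if j = x0 i then ?r else 0)))"
      proof (rule sum.cong)
        fix j assume j: "j \<in> {1..<N}"
        then have "score d c \<sigma> x t (x(i := j)) = ?r * c x i j"
          using i' unfolding a_def by (intro score_fun_upd) auto
        then show "\<sigma> t *
          (score d c \<sigma> x t (x(i := j)) - p t (x(i := j)) / p t x * ln (score d c \<sigma> x t (x(i := j)))
            + K (p t (x(i := j)) / p t x)) =
          \<sigma> t * (?r * c x i j - (if j = x0 i then ?r else 0) * ln (?r * c x i j)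
            + K (if j = x0 i then ?r else 0))"
          unfolding ratio[OF j] by (simp only:)
      qed simp
      also have "\<dots> = \<sigma> t * (\<Sum>j=1..<N. ?r * c x i j - (if j = x0 i then ?r else 0) * ln (?r * c x i j)
            + K (if j = x0 i then ?r else 0))"
        by (rule sum_distrib_left[symmetric])
      also have "\<dots> = \<sigma> t * - (?r * ln (c x i (x0 i)))"
      proof (rule arg_cong[where f = "\<lambda>y. \<sigma> t * y"], rule score_entropy_one_position[where w = "c x i", OF _ _ _ _ r])
        show "x0 i \<in> {1..<N}" by (rule x0[OF i'(1)])
        then show "(\<Sum>j=1..<N. c x i j) = 1" by (intro softmax_network_sum[OF network x i']) simp
        show "0 < c x i j" if "j \<in> {1..<N}" for j
          by (rule softmax_network_positive[OF network x i' that])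
      qed simp
      finally show ?thesis .
    qed
    have "dse_integrand N d c \<sigma> p t =
        (\<Sum>x\<in>seqs N d. p t x * (\<Sum>i\<in>?masked x. \<sigma> t * - (?r * ln (c x i (x0 i)))))"
      unfolding integrand
    proof (rule sum.cong)
      fix x assume x: "x \<in> seqs N d"
      show "p t x * (\<Sum>i\<in>?masked x. \<Sum>j=1..<N. \<sigma> t *
        (score d c \<sigma> x t (x(i := j)) - p t (x(i := j)) / p t x * ln (score d c \<sigma> x t (x(i := j)))
          + K (p t (x(i := j)) / p t x))) =
        p t x * (\<Sum>i\<in>?masked x. \<sigma> t * - (?r * ln (c x i (x0 i))))"
      proof (cases "p t x = 0")
        case False
        then show ?thesis using position[OF x] by (intro arg_cong[where f = "\<lambda>y. p t x * y"] sum.cong refl)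
      qed simp
    qed simp
    also have "\<dots> = (\<Sum>x\<in>?U ` Pow {1..d}. p t x * (\<Sum>i\<in>?masked x. \<sigma> t * - (?r * ln (c x i (x0 i)))))"
    proof (rule sum.mono_neutral_right)
      show "?U ` Pow {1..d} \<subseteq> seqs N d" using keep_only_in_seqs[OF clean] by auto
      show "\<forall>x\<in>seqs N d - ?U ` Pow {1..d}. p t x * (\<Sum>i\<in>?masked x. \<sigma> t * - (?r * ln (c x i (x0 i)))) = 0"
      proof
        fix x assume x: "x \<in> seqs N d - ?U ` Pow {1..d}"
        have "\<exists>i\<in>{1..d}. x i \<noteq> x0 i \<and> x i \<noteq> N"
        proof (rule ccontr)
          assume "\<not> ?thesis"
          \<comment> \<open>A sequence whose tokens are all original or masked is determined by the
            set of positions where it agrees with \<open>x0\<close>.\<close>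
          then have "x = ?U {i \<in> {1..d}. x i = x0 i}"
            using x by (auto simp: keep_only_def seqs_def PiE_iff extensional_def fun_eq_iff)
          with x show False by blast
        qed
        then have "p t x = 0" using x by (subst p) (auto intro!: prod_zero simp: absorb_kernel_def)
        then show "p t x * (\<Sum>i\<in>?masked x. \<sigma> t * - (?r * ln (c x i (x0 i)))) = 0" by simp
      qed
    qed (rule finite_seqs)
    also have "\<dots> = (\<Sum>U\<in>Pow {1..d}. p t (?U U) * (\<Sum>i\<in>?masked (?U U). \<sigma> t * - (?r * ln (c (?U U) i (x0 i)))))"
      by (subst sum.reindex[OF inj_on_keep_only[OF clean]]) (simp only: o_def)
    also have "\<dots> = (\<Sum>U\<in>Pow {1..d}. \<Sum>i\<in>{1..d} - U.
      token_nll N d c x0 U i * (a ^ card U * (1 - a) ^ (d - card U - 1) * a * \<sigma> t))"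
    proof (rule sum.cong)
      fix U assume U: "U \<in> Pow {1..d}"
      have masked: "?masked (?U U) = {1..d} - U" using U x0 by (force simp: keep_only_def)
      have card: "card ({1..d} - U) = d - card U"
        using U by (subst card_Diff_subset) (auto intro: finite_subset)
      have "p t (?U U) = (\<Prod>i=1..d. if i \<in> U then a else 1 - a)"
        unfolding p[OF keep_only_in_seqs[OF clean]] a_def[symmetric]
        by (rule prod.cong) (use x0 in \<open>force simp: keep_only_def absorb_kernel_def\<close>)+
      also have "\<dots> = a ^ card U * (1 - a) ^ (d - card U)"
      proof -
        have "{1..d} \<inter> {i. i \<in> U} = U" "{1..d} \<inter> - {i. i \<in> U} = {1..d} - U" using U by auto
        then show ?thesis using card by (simp add: prod.If_cases)
      qed
      finally have pU: "p t (?U U) = a ^ card U * (1 - a) ^ (d - card U)" .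
      show "p t (?U U) * (\<Sum>i\<in>?masked (?U U). \<sigma> t * - (?r * ln (c (?U U) i (x0 i)))) =
        (\<Sum>i\<in>{1..d} - U. token_nll N d c x0 U i * (a ^ card U * (1 - a) ^ (d - card U - 1) * a * \<sigma> t))"
        unfolding masked sum_distrib_left
      proof (rule sum.cong)
        fix i assume "i \<in> {1..d} - U"
        then have "card ({1..d} - U) > 0" by (auto simp: card_gt_0_iff)
        \<comment> \<open>The masked position \<open>i\<close> forces \<open>card U < d\<close>, so
          a factor \<open>1 - a\<close> is present to cancel the denominator of
          \<open>?r\<close>.\<close>
        then obtain m where m: "d - card U = Suc m" unfolding card using gr0_implies_Suc by blast
        have weight: "p t (?U U) * ?r = a ^ card U * (1 - a) ^ (d - card U - 1) * a"
          unfolding pU m using a by simp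
        show "p t (?U U) * (\<sigma> t * - (?r * ln (c (?U U) i (x0 i)))) =
          token_nll N d c x0 U i * (a ^ card U * (1 - a) ^ (d - card U - 1) * a * \<sigma> t)"
          unfolding token_nll_def weight[symmetric] by (simp only: mult_minus_left mult_minus_right mult_ac)
      qed simp
    qed simp
    finally show ?thesis unfolding if_not_P[OF False] .
  qed
qed

section \<open>Integration over time and the limit of large noise\<close>

lemma dse_integrand_has_integral:
  assumes clean: "x0 \<in> clean_seqs N d" and network: "softmax_network N d c" and "0 \<le> T"
    and int: "\<sigma> integrable_on {0..T}" and nonneg: "\<And>t. t \<in> {0..T} \<Longrightarrow> 0 \<le> \<sigma> t"
    and process: "forward_process M N d \<sigma> T x0 X"
  shows "(dse_integrand N d c \<sigma> (marginal M d X) has_integral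
    (\<Sum>U\<in>Pow {1..d}. \<Sum>i\<in>{1..d} - U. token_nll N d c x0 U i *
      beta_tail (card U) (d - card U - 1) (exp (- sigma_bar \<sigma> T)))) {0..T}"
proof -
  define a where "a t = exp (- sigma_bar \<sigma> t)" for t
  define f where "f t = (\<Sum>U\<in>Pow {1..d}. \<Sum>i\<in>{1..d} - U. token_nll N d c x0 U i *
    (a t ^ card U * (1 - a t) ^ (d - card U - 1) * a t * \<sigma> t))" for t
  define G where "G s = (\<Sum>U\<in>Pow {1..d}. \<Sum>i\<in>{1..d} - U. token_nll N d c x0 U i *
    beta_tail (card U) (d - card U - 1) (exp (- s)))" for s
  have "((\<lambda>t. if sigma_bar \<sigma> t = 0 then 0 else f t) has_integral G (sigma_bar \<sigma> T)) {0..T}"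
  proof (rule has_integral_zero_before_noise[OF \<open>0 \<le> T\<close> int nonneg])
    \<comment> \<open>Splitting off the noise-free interval requires the integral up to every
      intermediate time.\<close>
    fix s assume s: "s \<in> {0..T}"
    have "\<sigma> integrable_on {0..s}" by (rule integrable_on_subinterval[OF int]) (use s in auto)
    then show "(f has_integral G (sigma_bar \<sigma> s)) {0..s}"
      unfolding f_def G_def a_def using s nonneg
      by (intro has_integral_sum has_integral_mult_right has_integral_noise_beta) auto
  next
    show "G 0 = 0" by (simp add: G_def beta_tail_def)
  qed
  moreover have "(if sigma_bar \<sigma> t = 0 then 0 else f t) = dse_integrand N d c \<sigma> (marginal M d X) t"
    if "t \<in> {0..T}" for t
    unfolding f_def a_def
  proof (rule dse_integrand_eq[where p = "marginal M d X" and t = t and \<sigma> = \<sigma>, symmetric, OF clean network])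
    show "0 \<le> sigma_bar \<sigma> t" by (rule sigma_bar_nonneg[OF int nonneg that])
    show "marginal M d X t x = (\<Prod>i=1..d. absorb_kernel N (exp (- sigma_bar \<sigma> t)) (x0 i) (x i))"
      if "x \<in> seqs N d" for x
      by (rule marginal_forward_process[OF clean process int nonneg \<open>t \<in> {0..T}\<close> that])
  qed
  ultimately show ?thesis unfolding G_def by (rule has_integral_eq[rotated])
qed

theorem theorem2:
  fixes N d :: nat
    and x0 :: tokseq
    and c :: "tokseq \<Rightarrow> nat \<Rightarrow> nat \<Rightarrow> real"
    and F :: "'k filter"
    and \<sigma> :: "'k \<Rightarrow> real \<Rightarrow> real"
    and T :: "'k \<Rightarrow> real"
    and M :: "'k \<Rightarrow> 'w measure"
    and X :: "'k \<Rightarrow> nat \<Rightarrow> real \<Rightarrow> 'w \<Rightarrow> nat"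
  assumes clean: "x0 \<in> clean_seqs N d"
    and network: "softmax_network N d c"
    and horizon: "\<And>k. 0 < T k"
    and noise_nonneg: "\<And>k t. t \<in> {0..T k} \<Longrightarrow> 0 \<le> \<sigma> k t"
    and noise_integrable: "\<And>k. \<sigma> k integrable_on {0..T k}"
    and process: "\<And>k. forward_process (M k) N d (\<sigma> k) (T k) x0 (X k)"
    and total_noise: "filterlim (\<lambda>k. sigma_bar (\<sigma> k) (T k)) at_top F"
  shows "(\<forall>k. dse_integrand N d c (\<sigma> k) (marginal (M k) d (X k)) integrable_on {0..T k}) \<and>
         ((\<lambda>k. dse_loss N d c (\<sigma> k) (T k) (marginal (M k) d (X k))) \<longlongrightarrow> ao_loss N d c x0) F"
proof -
  \<comment> \<open>The loss depends on \<open>k\<close> only through the argument \<open>e\<close>,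
    so the one-sided limit of \<open>L\<close> at 0 settles the limit along any filter.\<close>
  define L where "L e = (\<Sum>U\<in>Pow {1..d}. \<Sum>i\<in>{1..d} - U. token_nll N d c x0 U i *
    beta_tail (card U) (d - card U - 1) e)" for e
  have integral: "(dse_integrand N d c (\<sigma> k) (marginal (M k) d (X k)) has_integral
      L (exp (- sigma_bar (\<sigma> k) (T k)))) {0..T k}" for k
    unfolding L_def using horizon[of k]
    by (intro dse_integrand_has_integral clean network noise_integrable noise_nonneg process) auto
  then have loss: "dse_loss N d c (\<sigma> k) (T k) (marginal (M k) d (X k)) =
      L (exp (- sigma_bar (\<sigma> k) (T k)))" for k
    unfolding dse_loss_def by (rule integral_unique)
  have "(L \<longlongrightarrow> (\<Sum>U\<in>Pow {1..d}. \<Sum>i\<in>{1..d} - U. token_nll N d c x0 U i *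
      (fact (card U) * fact (d - card U - 1) / fact (card U + (d - card U - 1) + 1)))) (at_right 0)"
    unfolding L_def by (intro tendsto_sum tendsto_mult tendsto_const beta_tail_tendsto)
  also have "(\<Sum>U\<in>Pow {1..d}. \<Sum>i\<in>{1..d} - U. token_nll N d c x0 U i *
      (fact (card U) * fact (d - card U - 1) / fact (card U + (d - card U - 1) + 1))) = ao_loss N d c x0"
    unfolding ao_loss_eq
  proof (intro sum.cong refl)
    fix U i assume "U \<in> Pow {1..d}" "i \<in> {1..d} - U"
    \<comment> \<open>As \<open>i\<close> lies outside \<open>U\<close>, the subtraction is exact
      and the Beta denominator becomes the number of orders.\<close>
    then have "card U < card {1..d}" by (intro psubset_card_mono) auto
    then have "card U + (d - card U - 1) + 1 = d" by simp
    then show "token_nll N d c x0 U i *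
        (fact (card U) * fact (d - card U - 1) / fact (card U + (d - card U - 1) + 1)) =
      token_nll N d c x0 U i * (fact (card U) * fact (d - card U - 1) / fact d)"
      by (simp only:)
  qed
  finally have "(L \<longlongrightarrow> ao_loss N d c x0) (at_right 0)" .
  moreover have "filterlim (\<lambda>k. exp (- sigma_bar (\<sigma> k) (T k))) (at_right 0) F"
  proof (rule tendsto_imp_filterlim_at_right)
    have "filterlim (\<lambda>k. - sigma_bar (\<sigma> k) (T k)) at_bot F"
      using total_noise by (simp add: filterlim_uminus_at_top)
    then show "((\<lambda>k. exp (- sigma_bar (\<sigma> k) (T k))) \<longlongrightarrow> 0) F"
      by (rule filterlim_compose[OF exp_at_bot])
  qed simp
  ultimately have "((\<lambda>k. L (exp (- sigma_bar (\<sigma> k) (T k)))) \<longlongrightarrow> ao_loss N d c x0) F"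
    by (rule filterlim_compose)
  then show ?thesis using integral unfolding loss by blast
qed

end
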